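(* For each of the following parameters $(q,r,h)$, with $A=\frac{[r-h]_q}{[\gcd(r,h)]_q}$ and $B=\frac{[r]_q}{[\gcd(r,h)]_q}$, and for each listed triple $(i,c,\delta)$, we have for all sufficiently large integers $t$ $$n_q(r,h;At-i)=Bt-c\qquad\text{and}\qquad n_q(r,h;At-i)-\overline{n}_q(r,h;At-i)=\delta .$$ (1) $(q,r,h)=(2,8,2)$, $A=21$, $B=85$: $(13,55,2),(14,60,2),(18,76,2),(19,81,2)$. (2) $(q,r,h)=(3,6,2)$, $A=10$, $B=91$: $(7,67,3),(8,77,3),(9,87,3)$. (3) $(q,r,h)=(2,9,3)$, $A=9$, $B=73$: $(5,43,2),(6,52,2),(7,59,4),(8,68,4)$. (4) $(q,r,h)=(4,6,2)$, $A=17$, $B=273$: $(9,149,4),(10,166,4),(11,183,4),(12,200,4),(13,213,8),(14,230,8),(15,247,8),(16,264,8)$. (5) $(q,r,h)=(2,10,2)$, $A=85$, $B=341$: $(13,55,2),(14,60,2),(18,76,2),(19,81,2),(34,140,2),(35,145,2),(39,161,2),(40,166,2),(45,183,2),(46,188,2),(50,204,2),(51,209,2),(53,215,2),(54,220,2),(55,223,4),(56,228,4),(58,236,2),(59,241,2),(60,244,4),(61,249,4),(66,268,2),(67,273,2),(71,289,2),(72,294,2),(74,300,2),(75,305,2),(76,308,4),(77,313,4),(79,321,2),(80,326,2),(81,329,4),(82,334,4)$. (6) $(q,r,h)=(5,6,2)$, $A=26$, $B=651$: $(11,281,5),(12,307,5),(13,333,5),(14,359,5),(15,385,5),(16,406,10),(17,432,10),(18,458,10),(19,484,10),(20,510,10),(21,531,15),(22,557,15),(23,583,15),(24,609,15),(25,635,15)$.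 (7) $(q,r,h)=(2,12,4)$, $A=17$, $B=273$: $(7,117,2),(8,134,2),(9,147,6),(10,164,6),(11,179,8),(12,196,8),(13,213,8),(14,230,8),(15,245,10),(16,262,10)$. (8) $(q,r,h)=(3,9,3)$, $A=28$, $B=757$: $(10,274,6),(11,302,6),(12,330,6),(13,355,9),(14,383,9),(15,411,9),(16,439,9),(17,467,9),(18,495,9),(19,517,15),(20,545,15),(21,573,15),(22,598,18),(23,626,18),(24,654,18),(25,682,18),(26,710,18),(27,738,18)$. (9) $(q,r,h)=(3,8,2)$, $A=91$, $B=820$: $(7,67,3),(8,77,3),(9,87,3),(17,158,3),(18,168,3),(19,178,3),(27,249,3),(28,259,3),(29,269,3),(34,310,3),(35,320,3),(36,330,3),(37,337,6),(38,347,6),(39,357,6),(44,401,3),(45,411,3),(46,421,3),(47,428,6),(48,438,6),(49,448,6),(54,492,3),(55,502,3),(56,512,3),(57,519,6),(58,529,6),(59,539,6),(61,553,3),(62,563,3),(63,573,3),(64,580,6),(65,590,6),(66,600,6),(67,607,9),(68,617,9),(69,627,9),(71,644,3),(72,654,3),(73,664,3),(74,671,6),(75,681,6),(76,691,6),(77,698,9),(78,708,9),(79,718,9),(81,735,3),(82,745,3),(83,755,3),(84,762,6),(85,772,6),(86,782,6),(87,789,9),(88,799,9),(89,809,9)$.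
   Context: Notation: $[i]_q=\frac{q^i-1}{q-1}$. $\mathrm{PG}(r-1,q)$ denotes the lattice of subspaces of $\mathbb{F}_q^r$; dimensions are vector space dimensions, and hyperplanes are the $(r-1)$-dimensional subspaces. A projective $h-(n,r,s)_q$ system is a multiset $\mathcal{S}$ of $n$ subspaces of $\mathrm{PG}(r-1,q)$ of dimension at most $h$ such that each hyperplane contains at most $s$ elements of $\mathcal{S}$ (counted with multiplicity) and some hyperplane contains exactly $s$ elements. $n_q(r,h;s)$ denotes the maximum $n$ such that a projective $h-(n,r,s)_q$ system exists, and $\overline{n}_q(r,h;s):=n_{q^h}(\lceil r/h\rceil,1;s)$ (the corresponding maximum obtainable from linear codes over $\mathbb{F}_{q^h}$). *)

theory Defs
  imports "HOL-Analysis.Analysis" "HOL-Library.Multiset"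
begin

definition q_number :: "nat \<Rightarrow> nat \<Rightarrow> rat" where
  "q_number q i = (of_nat q ^ i - 1) / (of_nat q - 1)"

(* The type 'a ^ 'n plays the role of F_q^r with q = CARD('a) and r = CARD('n). *)

definition hyperplane :: "('a::{field,finite} ^ 'n) set \<Rightarrow> bool" where
  "hyperplane H \<longleftrightarrow> vec.subspace H \<and> vec.dim H + 1 = CARD('n)"

definition contained_count :: "'v set multiset \<Rightarrow> 'v set \<Rightarrow> nat" where
  "contained_count S H = size {#U \<in># S. U \<subseteq> H#}"

(* A projective h-(n,r,s)_q system. As the bound h is on the dimension from above only,
   elements of smaller dimension, including the zero subspace, are allowed. *)
definition projective_system ::
    "nat \<Rightarrow> nat \<Rightarrow> nat \<Rightarrow> ('a::{field,finite} ^ 'n) set multiset \<Rightarrow> bool" where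
  "projective_system h n s S \<longleftrightarrow>
     size S = n \<and>
     (\<forall>U \<in># S. vec.subspace U \<and> vec.dim U \<le> h) \<and>
     (\<forall>H. hyperplane H \<longrightarrow> contained_count S H \<le> s) \<and>
     (\<exists>H. hyperplane H \<and> contained_count S H = s)"

(* n_q(r,h;s), the ambient space F_q^r being passed as a type. For h < r and r >= 2
   the maximum exists: s copies of the zero subspace form a system, and every element lies
   in one of the finitely many hyperplanes, each of which contains at most s elements. *)
definition max_system_size :: "('a::{field,finite} ^ 'n) itself \<Rightarrow> nat \<Rightarrow> nat \<Rightarrow> nat" where
  "max_system_size _ h s =
     (GREATEST n. \<exists>S :: ('a ^ 'n) set multiset. projective_system h n s S)"

(* Entries ((q, r, h), (A, B), set of triples (i, c, delta)). *)
definition parameter_table ::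
    "((nat \<times> nat \<times> nat) \<times> (nat \<times> nat) \<times> (nat \<times> nat \<times> nat) set) set" where
  "parameter_table = {
    ((2, 8, 2), (21, 85),
     {(13,55,2), (14,60,2), (18,76,2), (19,81,2)}),
    ((3, 6, 2), (10, 91),
     {(7,67,3), (8,77,3), (9,87,3)}),
    ((2, 9, 3), (9, 73),
     {(5,43,2), (6,52,2), (7,59,4), (8,68,4)}),
    ((4, 6, 2), (17, 273),
     {(9,149,4), (10,166,4), (11,183,4), (12,200,4), (13,213,8), (14,230,8),
      (15,247,8), (16,264,8)}),
    ((2, 10, 2), (85, 341),
     {(13,55,2), (14,60,2), (18,76,2), (19,81,2), (34,140,2), (35,145,2),
      (39,161,2), (40,166,2), (45,183,2), (46,188,2), (50,204,2), (51,209,2),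
      (53,215,2), (54,220,2), (55,223,4), (56,228,4), (58,236,2), (59,241,2),
      (60,244,4), (61,249,4), (66,268,2), (67,273,2), (71,289,2), (72,294,2),
      (74,300,2), (75,305,2), (76,308,4), (77,313,4), (79,321,2), (80,326,2),
      (81,329,4), (82,334,4)}),
    ((5, 6, 2), (26, 651),
     {(11,281,5), (12,307,5), (13,333,5), (14,359,5), (15,385,5), (16,406,10),
      (17,432,10), (18,458,10), (19,484,10), (20,510,10), (21,531,15), (22,557,15),
      (23,583,15), (24,609,15), (25,635,15)}),
    ((2, 12, 4), (17, 273),
     {(7,117,2), (8,134,2), (9,147,6), (10,164,6), (11,179,8), (12,196,8),
      (13,213,8), (14,230,8), (15,245,10), (16,262,10)}),
    ((3, 9, 3), (28, 757),
     {(10,274,6), (11,302,6), (12,330,6), (13,355,9), (14,383,9), (15,411,9),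
      (16,439,9), (17,467,9), (18,495,9), (19,517,15), (20,545,15), (21,573,15),
      (22,598,18), (23,626,18), (24,654,18), (25,682,18), (26,710,18), (27,738,18)}),
    ((3, 8, 2), (91, 820),
     {(7,67,3), (8,77,3), (9,87,3), (17,158,3), (18,168,3), (19,178,3),
      (27,249,3), (28,259,3), (29,269,3), (34,310,3), (35,320,3), (36,330,3),
      (37,337,6), (38,347,6), (39,357,6), (44,401,3), (45,411,3), (46,421,3),
      (47,428,6), (48,438,6), (49,448,6), (54,492,3), (55,502,3), (56,512,3),
      (57,519,6), (58,529,6), (59,539,6), (61,553,3), (62,563,3), (63,573,3),
      (64,580,6), (65,590,6), (66,600,6), (67,607,9), (68,617,9), (69,627,9),
      (71,644,3), (72,654,3), (73,664,3), (74,671,6), (75,681,6), (76,691,6),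
      (77,698,9), (78,708,9), (79,718,9), (81,735,3), (82,745,3), (83,755,3),
      (84,762,6), (85,772,6), (86,782,6), (87,789,9), (88,799,9), (89,809,9)})}"

end

theory Submission
  imports Defs
begin

text \<open>
  Write \<open>[k]\<close> for \<open>qnum q k\<close> and call the number of elements of a system outside a hyperplane the
  missing number. Both maxima are given by a Griesmer bound, which is attained for large \<open>t\<close>.

  Upper bound. After enlarging all elements to dimension \<open>h\<close>, give each subspace \<open>W\<close> the weight
  \<open>\<Sum>U. [dim (U \<inter> W)]\<close>. The weights of the \<open>q + 1\<close> hyperplanes of \<open>W\<close> through a subspace \<open>X\<close> of
  codimension two add up to the weight of \<open>W\<close> plus \<open>q\<close> times that of \<open>X\<close>, so passing to a heaviest
  hyperplane divides the missing weight by at most \<open>q\<close>; iterate.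

  Lower bound. Allow integer multiplicities first. Fix \<open>K\<close> of dimension \<open>h - 1\<close> and let \<open>D W\<close> consist
  of the \<open>h\<close>-spaces between \<open>K\<close> and \<open>W\<close>; as a function on points \<open>D W\<close> is \<open>\<chi>\<^sub>W + q [dim W - h] \<chi>\<^sub>K\<close>.
  For \<open>dim W = h + 1\<close> the combination of \<open>[h]\<close> times \<open>D W\<close> and minus one times all \<open>h\<close>-spaces of \<open>W\<close> is
  \<open>q [h] \<chi>\<^sub>K\<close>. So \<open>\<Sum>e. b\<^sub>e \<chi>\<^bsub>W\<^sub>e\<^esub>\<close> with \<open>dim W\<^sub>e = h + e\<close> comes from a virtual system as soon as \<open>[h]\<close>
  divides \<open>\<Sum>e. b\<^sub>e [e]\<close>. Negative multiplicities are removed by adding a system in which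
  every \<open>h\<close>-space occurs and all hyperplanes miss the same number of elements.
\<close>

subsection \<open>Counting subspaces\<close>

text \<open>A geometric sum in the naturals, free of division; for \<open>q \<ge> 2\<close> it
  agrees with \<open>q_number\<close>.\<close>

definition qnum :: "nat \<Rightarrow> nat \<Rightarrow> nat" where
  "qnum q k = (\<Sum>j<k. q ^ j)"

lemma qnum_0 [simp]: "qnum q 0 = 0"
  and qnum_1 [simp]: "qnum q (Suc 0) = 1"
  by (simp_all add: qnum_def)

lemma qnum_add: "qnum q (a + b) = qnum q a + q ^ a * qnum q b"
proof (induction b)
  case (Suc b)
  then show ?case
    by (simp add: qnum_def algebra_simps power_add)
qed simp

lemma qnum_Suc: "qnum q (Suc k) = 1 + q * qnum q k"
  using qnum_add[of q 1 k] by simp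

lemma qnum_Suc': "qnum q (Suc k) = qnum q k + q ^ k"
  by (simp add: qnum_def)

lemma power_eq_qnum: "q \<ge> 1 \<Longrightarrow> q ^ k = 1 + (q - 1) * qnum q k"
proof (induction k)
  case (Suc k)
  have "(q - 1) * qnum q (Suc k) = (q - 1) * qnum q k + (q - 1) * q ^ k"
    by (simp add: qnum_Suc' algebra_simps)
  moreover have "q ^ Suc k = q ^ k + (q - 1) * q ^ k"
    using Suc.prems by (cases q) simp_all
  ultimately show ?case
    using Suc by simp
qed simp

section \<open>Cardinality and dimension of subspaces\<close>

lemma card_field_gt_1: "1 < CARD('a::{field,finite})"
proof -
  have "card {0::'a, 1} \<le> CARD('a)"
    by (rule card_mono) auto
  then show ?thesis
    by simp
qed

text \<open>Induction on a basis: adjoining \<open>b\<close> outside \<open>vec.span B\<close> makes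
  the new span a bijective image of the pairs of a scalar and an old vector.\<close>

lemma card_subspace:
  fixes U :: "('a::{field,finite} ^ 'n) set"
  assumes "vec.subspace U"
  shows "card U = CARD('a) ^ vec.dim U"
proof -
  have span: "card (vec.span B) = CARD('a) ^ card B"
    if "finite B" "vec.independent B" for B :: "('a ^ 'n) set"
    using that
  proof (induction B rule: finite_induct)
    case (insert b B)
    have b: "b \<notin> vec.span B" and ind: "vec.independent B"
      using insert.prems insert.hyps by (auto simp: vec.independent_insert)
    let ?f = "\<lambda>(c, x). c *s b + x"
    have "inj_on ?f (UNIV \<times> vec.span B)"
    proof (rule inj_onI, clarify)
      fix c x d y
      assume x: "x \<in> vec.span B" and y: "y \<in> vec.span B" and eq: "c *s b + x = d *s b + y"
      have "(c - d) *s b = y - x"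
        using eq by (simp add: vec.scale_left_diff_distrib algebra_simps)
      then have "(c - d) *s b \<in> vec.span B"
        using x y by (simp add: vec.span_diff)
      \<comment> \<open>Otherwise scaling by the inverse of \<open>c - d\<close> would put
        \<open>b\<close> into \<open>vec.span B\<close>.\<close>
      then have "c = d"
        using b by (metis left_inverse right_minus_eq vec.scale_one vec.scale_scale vec.span_scale)
      with eq show "c = d \<and> x = y"
        by simp
    qed
    moreover have "vec.span (insert b B) = ?f ` (UNIV \<times> vec.span B)"
    proof
      show "vec.span (insert b B) \<subseteq> ?f ` (UNIV \<times> vec.span B)"
      proof
        fix x assume "x \<in> vec.span (insert b B)"
        then obtain c where "x - c *s b \<in> vec.span B"
          by (auto simp: vec.span_insert)
        then show "x \<in> ?f ` (UNIV \<times> vec.span B)"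
          by (intro image_eqI[of _ _ "(c, x - c *s b)"]) auto
      qed
      show "?f ` (UNIV \<times> vec.span B) \<subseteq> vec.span (insert b B)"
      proof (clarify)
        fix c x assume "x \<in> vec.span B"
        then have "c *s b + x - c *s b \<in> vec.span B"
          by simp
        then show "c *s b + x \<in> vec.span (insert b B)"
          unfolding vec.span_insert by blast
      qed
    qed
    ultimately have "card (vec.span (insert b B)) = card ((UNIV :: 'a set) \<times> vec.span B)"
      by (simp add: card_image)
    then show ?case
      using insert.IH[OF ind] insert.hyps by (simp add: card_cartesian_product)
  qed simp
  obtain B where B: "B \<subseteq> U" "vec.independent B" "U \<subseteq> vec.span B" "card B = vec.dim U"
    using vec.basis_exists by blast
  have "vec.span B = U"
    using B assms by (metis vec.span_minimal subset_antisym)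
  then show ?thesis
    using span[of B] B by simp
qed

lemma subspace_between:
  fixes K W :: "('a::field ^ 'n) set"
  assumes "vec.subspace K" "vec.subspace W" "K \<subseteq> W" "vec.dim K \<le> m" "m \<le> vec.dim W"
  obtains U where "vec.subspace U" "K \<subseteq> U" "U \<subseteq> W" "vec.dim U = m"
proof -
  have "\<exists>U. vec.subspace U \<and> K \<subseteq> U \<and> U \<subseteq> W \<and> vec.dim U = m"
    using assms(4,5)
  proof (induction m rule: dec_induct)
    case base
    then show ?case using assms by blast
  next
    case (step m)
    then obtain U where U: "vec.subspace U" "K \<subseteq> U" "U \<subseteq> W" "vec.dim U = m"
      by auto
    have "U \<noteq> W"
      using U step by auto
    then obtain x where x: "x \<in> W" "x \<notin> U"
      using U by blast
    have "vec.dim (vec.span (insert x U)) = Suc m"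
      using U x by (simp add: vec.dim_insert vec.span_eq_iff[THEN iffD2])
    moreover have "vec.span (insert x U) \<subseteq> W"
      using U x assms by (intro vec.span_minimal) auto
    moreover have "K \<subseteq> vec.span (insert x U)"
      using U vec.span_superset[of "insert x U"] by auto
    ultimately show ?case
      by (intro exI[of _ "vec.span (insert x U)"]) simp
  qed
  then show ?thesis
    using that by blast
qed

text \<open>One vector of \<open>U\<close> outside \<open>H\<close> gives the sum of
  \<open>U\<close> and \<open>H\<close> the dimension of \<open>W\<close>; the dimension formula for
  sums then leaves a drop of exactly one.\<close>

lemma dim_Int_hyperplane_of:
  fixes U H W :: "('a::field ^ 'n) set"
  assumes "vec.subspace U" "vec.subspace H" "vec.subspace W" "U \<subseteq> W" "H \<subseteq> W"
    and "vec.dim W = Suc (vec.dim H)" "\<not> U \<subseteq> H"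
  shows "vec.dim U = Suc (vec.dim (U \<inter> H))"
proof -
  let ?S = "{x + y |x y. x \<in> U \<and> y \<in> H}"
  have "vec.dim ?S + vec.dim (U \<inter> H) = vec.dim U + vec.dim H"
    using assms by (intro vec.dim_sums_Int)
  moreover have "vec.dim ?S = vec.dim W"
  proof (rule antisym)
    show "vec.dim ?S \<le> vec.dim W"
      using assms by (intro vec.dim_subset) (auto intro: vec.subspace_add)
    obtain x where x: "x \<in> U" "x \<notin> H"
      using assms by auto
    have "insert x H \<subseteq> ?S"
    proof -
      have "x = x + 0" "0 \<in> H" "0 \<in> U"
        using assms by (auto intro: vec.subspace_0)
      then have "x \<in> ?S" using x by blast
      moreover have "y \<in> ?S" if "y \<in> H" for y
        using that \<open>0 \<in> U\<close> by (metis (mono_tags, lifting) add_0 mem_Collect_eq)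
      ultimately show ?thesis by auto
    qed
    then have "vec.dim (insert x H) \<le> vec.dim ?S"
      by (rule vec.dim_subset)
    then show "vec.dim W \<le> vec.dim ?S"
      using x assms by (simp add: vec.dim_insert vec.span_eq_iff[THEN iffD2])
  qed
  ultimately show ?thesis
    using assms by simp
qed

lemma dim_Int_hyperplane:
  fixes U H :: "('a::{field,finite} ^ 'n) set"
  assumes "vec.subspace U" "hyperplane H" "\<not> U \<subseteq> H"
  shows "vec.dim U = Suc (vec.dim (U \<inter> H))"
  using assms dim_Int_hyperplane_of[of U H UNIV]
  by (auto simp: hyperplane_def vec.subspace_UNIV vec_dim_card card_cart_basis)

section \<open>Subspaces one dimension above a fixed subspace\<close>

text \<open>For subspaces \<open>K \<subseteq> W\<close> these correspond to the projective points
  of the quotient of \<open>W\<close> by \<open>K\<close>.\<close>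

definition covers :: "('a::field ^ 'n) set \<Rightarrow> ('a ^ 'n) set \<Rightarrow> ('a ^ 'n) set set" where
  "covers K W = {U. vec.subspace U \<and> K \<subseteq> U \<and> U \<subseteq> W \<and> vec.dim U = Suc (vec.dim K)}"

lemma cover_eq_span:
  fixes K U :: "('a::field ^ 'n) set"
  assumes "vec.subspace K" "U \<in> covers K W" "x \<in> U" "x \<notin> K"
  shows "U = vec.span (insert x K)"
proof -
  have "vec.span (insert x K) \<subseteq> U"
    using assms by (intro vec.span_minimal) (auto simp: covers_def)
  moreover have "vec.dim (vec.span (insert x K)) = vec.dim U"
    using assms by (simp add: covers_def vec.dim_insert vec.span_eq_iff[THEN iffD2])
  ultimately show ?thesis
    using assms vec.subspace_dim_equal[of "vec.span (insert x K)" U] by (simp add: covers_def)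
qed

lemma covers_disjoint:
  fixes K :: "('a::field ^ 'n) set"
  assumes "vec.subspace K" "U \<in> covers K W" "U' \<in> covers K W" "U \<noteq> U'"
  shows "(U - K) \<inter> (U' - K) = {}"
  using assms cover_eq_span by blast

lemma Union_covers:
  fixes K :: "('a::field ^ 'n) set"
  assumes "vec.subspace K" "vec.subspace W" "K \<subseteq> W"
  shows "(\<Union>U\<in>covers K W. U - K) = W - K"
proof
  show "W - K \<subseteq> (\<Union>U\<in>covers K W. U - K)"
  proof
    fix x assume x: "x \<in> W - K"
    have "vec.span (insert x K) \<subseteq> W"
      using x assms by (intro vec.span_minimal) auto
    moreover have "K \<subseteq> vec.span (insert x K)"
      using vec.span_superset[of "insert x K"] by simp
    ultimately have "vec.span (insert x K) \<in> covers K W"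
      using x assms by (simp add: covers_def vec.dim_insert vec.span_eq_iff[THEN iffD2])
    moreover have "x \<in> vec.span (insert x K)"
      by (simp add: vec.span_base)
    ultimately show "x \<in> (\<Union>U\<in>covers K W. U - K)"
      using x by blast
  qed
qed (auto simp: covers_def)

text \<open>The sets \<open>U - K\<close> partition \<open>W - K\<close>, of size
  \<open>q^k (q^m - 1)\<close>, into blocks of size \<open>(q - 1) q^k\<close>, where
  \<open>k = dim K\<close>.\<close>

lemma card_covers:
  fixes K W :: "('a::{field,finite} ^ 'n) set"
  assumes K: "vec.subspace K" and W: "vec.subspace W" "K \<subseteq> W" and m: "vec.dim W = vec.dim K + m"
  shows "card (covers K W) = qnum CARD('a) m"
proof -
  let ?q = "CARD('a)" and ?k = "vec.dim K"
  have q: "1 < ?q"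
    by (rule card_field_gt_1)
  have one: "card (U - K) = (?q - 1) * ?q ^ ?k" if "U \<in> covers K W" for U
    using that K by (subst card_Diff_subset) (auto simp: covers_def card_subspace diff_mult_distrib)
  have "card (\<Union>U\<in>covers K W. U - K) = (\<Sum>U\<in>covers K W. card (U - K))"
    using covers_disjoint[OF K] by (intro card_UN_disjoint) auto
  also have "\<dots> = card (covers K W) * ((?q - 1) * ?q ^ ?k)"
    using one by simp
  also have "(\<Union>U\<in>covers K W. U - K) = W - K"
    by (rule Union_covers[OF K W])
  also have "card (W - K) = ?q ^ ?k * (?q ^ m - 1)"
    using K W m by (subst card_Diff_subset) (auto simp: card_subspace power_add algebra_simps)
  also have "?q ^ m - 1 = (?q - 1) * qnum ?q m"
    using power_eq_qnum[of ?q m] q by simp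
  finally have "(?q - 1) * ?q ^ ?k * qnum ?q m = (?q - 1) * ?q ^ ?k * card (covers K W)"
    by (simp add: mult_ac)
  then show ?thesis
    using q by simp
qed

text \<open>If \<open>K\<close> but not \<open>W\<close> lies in \<open>H\<close>, the covers inside
  \<open>H\<close> are those inside \<open>W \<inter> H\<close>, so
  \<open>[m] - [m - 1] = q^(m - 1)\<close> remain. In that case \<open>m\<close> is positive and
  \<open>m - 1\<close> is not truncated.\<close>

lemma card_covers_Collect:
  fixes K W H :: "('a::{field,finite} ^ 'n) set"
  assumes "vec.subspace K" "vec.subspace W" "K \<subseteq> W" "vec.dim W = vec.dim K + m" "hyperplane H"
  shows "card {U \<in> covers K W. \<not> U \<subseteq> H} =
    (if \<not> K \<subseteq> H then qnum CARD('a) m else if W \<subseteq> H then 0 else CARD('a) ^ (m - 1))"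
proof -
  have H: "vec.subspace H"
    using assms by (simp add: hyperplane_def)
  consider "\<not> K \<subseteq> H" | "W \<subseteq> H" "K \<subseteq> H" | "K \<subseteq> H" "\<not> W \<subseteq> H"
    by blast
  then show ?thesis
  proof cases
    case 1
    then have "{U \<in> covers K W. \<not> U \<subseteq> H} = covers K W"
      by (auto simp: covers_def)
    then show ?thesis
      using 1 card_covers[OF assms(1-4)] by simp
  next
    case 2
    then have "{U \<in> covers K W. \<not> U \<subseteq> H} = {}"
      by (auto simp: covers_def)
    then have "card {U \<in> covers K W. \<not> U \<subseteq> H} = 0"
      by (simp only: card.empty)
    then show ?thesis
      using 2 by simp
  next
    case 3
    have d: "vec.dim W = Suc (vec.dim (W \<inter> H))"
      using assms 3 by (intro dim_Int_hyperplane)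
    have sub: "K \<subseteq> W \<inter> H" "vec.subspace (W \<inter> H)"
      using 3 assms H by (auto intro: vec.subspace_inter)
    have "vec.dim K \<le> vec.dim (W \<inter> H)"
      using sub by (intro vec.dim_subset)
    then obtain m' where m': "m = Suc m'" "vec.dim (W \<inter> H) = vec.dim K + m'"
      using d assms(4) by (cases m) (auto simp: le_iff_add)
    have "{U \<in> covers K W. \<not> U \<subseteq> H} = covers K W - covers K (W \<inter> H)"
      by (auto simp: covers_def)
    moreover have "covers K (W \<inter> H) \<subseteq> covers K W"
      by (auto simp: covers_def)
    ultimately have "card {U \<in> covers K W. \<not> U \<subseteq> H} =
        card (covers K W) - card (covers K (W \<inter> H))"
      by (simp add: card_Diff_subset)
    also have "\<dots> = CARD('a) ^ m'"
      using card_covers[OF assms(1-4)] card_covers[OF assms(1) sub(2,1) m'(2)] m'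
      by (simp add: qnum_Suc')
    finally show ?thesis
      using 3 m' by simp
  qed
qed

section \<open>Hyperplanes of a subspace\<close>

text \<open>Written with \<open>Suc\<close> instead of a truncated difference, so that the zero
  space has no facets.\<close>

definition facets :: "('a::field ^ 'n) set \<Rightarrow> ('a ^ 'n) set set" where
  "facets W = {U. vec.subspace U \<and> U \<subseteq> W \<and> Suc (vec.dim U) = vec.dim W}"

text \<open>Fix a facet \<open>U0\<close>. Every other facet meets \<open>U0\<close> in a facet
  \<open>K\<close> of \<open>U0\<close>, and each \<open>K\<close> has \<open>q + 1\<close> covers
  in \<open>W\<close>, one of which is \<open>U0\<close>. This gives
  \<open>1 + q [m] = [m + 1]\<close>.\<close>

lemma card_facets:
  fixes W :: "('a::{field,finite} ^ 'n) set"
  assumes "vec.subspace W"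
  shows "card (facets W) = qnum CARD('a) (vec.dim W)"
  using assms
proof (induction "vec.dim W" arbitrary: W)
  case 0
  then have "Suc (vec.dim U) \<noteq> vec.dim W" for U :: "('a ^ 'n) set"
    by linarith
  then have "facets W = {}"
    unfolding facets_def by blast
  then show ?case
    by (simp only: card.empty qnum_0 0(1)[symmetric])
next
  case (Suc m)
  let ?q = "CARD('a)"
  obtain U0 where U0: "vec.subspace U0" "U0 \<subseteq> W" "vec.dim U0 = m"
    using subspace_between[of "{0}" W m] Suc by (auto simp: vec.subspace_0)
  \<comment> \<open>For a facet \<open>K\<close> of \<open>U0\<close>, these are the facets of
    \<open>W\<close> that meet \<open>U0\<close> exactly in \<open>K\<close>.\<close>
  let ?C = "\<lambda>K. covers K W - {U0}"
  have Cc: "card (?C K) = ?q" if "K \<in> facets U0" for K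
  proof -
    have "U0 \<in> covers K W" "vec.dim W = vec.dim K + 2" "vec.subspace K" "K \<subseteq> W"
      using that U0 Suc by (auto simp: covers_def facets_def)
    then show ?thesis
      using card_covers[of K W 2] Suc by (simp add: qnum_Suc numeral_2_eq_2)
  qed
  have Int: "U \<inter> U0 \<in> facets U0" "U \<in> covers (U \<inter> U0) W"
    if "U \<in> facets W" "U \<noteq> U0" for U
  proof -
    have U: "vec.subspace U" "U \<subseteq> W" "vec.dim U = m"
      using that Suc by (auto simp: facets_def)
    then have "\<not> U \<subseteq> U0"
      using that U0 vec.subspace_dim_equal[of U U0] by auto
    then have "vec.dim U = Suc (vec.dim (U \<inter> U0))"
      using dim_Int_hyperplane_of[of U U0 W] U U0 Suc by simp
    then show "U \<inter> U0 \<in> facets U0" "U \<in> covers (U \<inter> U0) W"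
      using U U0 by (auto simp: facets_def covers_def vec.subspace_inter)
  qed
  have Int_eq: "U \<inter> U0 = K" if "K \<in> facets U0" "U \<in> ?C K" for U K
  proof -
    have "U \<in> facets W" "U \<noteq> U0" "K \<subseteq> U \<inter> U0"
      using that U0 Suc by (auto simp: facets_def covers_def)
    with Int(1)[of U] show ?thesis
      using that vec.subspace_dim_equal[of K "U \<inter> U0"] by (auto simp: facets_def)
  qed
  have disj: "?C K \<inter> ?C K' = {}" if "K \<in> facets U0" "K' \<in> facets U0" "K \<noteq> K'" for K K'
    using Int_eq that by blast
  have "U \<in> facets W" if "K \<in> facets U0" "U \<in> ?C K" for K U
    using that U0 Suc(2) by (auto simp: facets_def covers_def)
  with Int have "facets W - {U0} = (\<Union>K\<in>facets U0. ?C K)"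
    by blast
  moreover have "card (\<Union>K\<in>facets U0. ?C K) = (\<Sum>K\<in>facets U0. card (?C K))"
    using disj by (intro card_UN_disjoint) auto
  moreover have "\<dots> = qnum ?q m * ?q"
    using Cc Suc(1)[of U0] U0 by simp
  moreover have "U0 \<in> facets W"
    using U0 Suc by (auto simp: facets_def)
  ultimately have "card (facets W) = 1 + qnum ?q m * ?q"
    by (metis card_Suc_Diff1 finite plus_1_eq_Suc)
  then show ?case
    using Suc(2) by (metis mult.commute qnum_Suc)
qed

subsection \<open>Virtual systems of subspaces\<close>

text \<open>If \<open>W\<close> is not inside \<open>H\<close>, then \<open>W \<inter> H\<close> is
  the only facet of \<open>W\<close> inside \<open>H\<close>, and
  \<open>[h + 1] - 1 = q [h]\<close>.\<close>

lemma card_facets_Collect: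
  fixes W H :: "('a::{field,finite} ^ 'n) set"
  assumes "vec.subspace W" "vec.dim W = Suc h" "hyperplane H"
  shows "card {U \<in> facets W. \<not> U \<subseteq> H} = (if W \<subseteq> H then 0 else CARD('a) * qnum CARD('a) h)"
proof (cases "W \<subseteq> H")
  case True
  then have "{U \<in> facets W. \<not> U \<subseteq> H} = {}"
    by (auto simp: facets_def)
  then have "card {U \<in> facets W. \<not> U \<subseteq> H} = 0"
    by (simp only: card.empty)
  then show ?thesis
    using True by simp
next
  case False
  have "vec.subspace H"
    using assms by (simp add: hyperplane_def)
  then have WH: "vec.subspace (W \<inter> H)" "vec.dim (W \<inter> H) = h"
    using dim_Int_hyperplane[of W H] assms False by (auto simp: vec.subspace_inter)
  then have mem: "W \<inter> H \<in> facets W"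
    using assms by (simp add: facets_def)
  have "U = W \<inter> H" if "U \<in> facets W" "U \<subseteq> H" for U
    using that WH assms vec.subspace_dim_equal[of U "W \<inter> H"] by (auto simp: facets_def)
  then have "{U \<in> facets W. \<not> U \<subseteq> H} = facets W - {W \<inter> H}"
    using False by auto
  then have "card {U \<in> facets W. \<not> U \<subseteq> H} = card (facets W) - 1"
    using mem by simp
  then show ?thesis
    using False assms card_facets[of W] by (simp add: qnum_Suc)
qed

lemma obtain_subspace_of_dim:
  assumes "m \<le> CARD('n)"
  obtains U :: "('a::field ^ 'n) set" where "vec.subspace U" "vec.dim U = m"
  using subspace_between[of "{0}" UNIV m] assms vec.subspace_0
  by (metis vec.dim_eq_0 vec.subspace_UNIV vec_dim_card le0 subset_UNIV subset_refl vec.subspace_single_0)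

text \<open>Multiplicities are integer-valued functions, not multisets, so that systems can be
  subtracted from one another.\<close>

definition virtual_system :: "nat \<Rightarrow> (('a::field ^ 'n) set \<Rightarrow> int) \<Rightarrow> bool" where
  "virtual_system h a \<longleftrightarrow> (\<forall>U. a U \<noteq> 0 \<longrightarrow> vec.subspace U \<and> vec.dim U = h)"

definition missing :: "('v set \<Rightarrow> int) \<Rightarrow> 'v set \<Rightarrow> int" where
  "missing a H = (\<Sum>U | \<not> U \<subseteq> H. a U)"

lemma sum_of_bool_mem:
  fixes S T :: "'b::finite set"
  shows "(\<Sum>U\<in>S. of_bool (U \<in> T) :: int) = int (card {U \<in> T. U \<in> S})"
proof -
  have "(\<Sum>U\<in>S. of_bool (U \<in> T) :: int) = int (card (S \<inter> {U. U \<in> T}))"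
    by (subst sum_of_bool_eq) auto
  also have "S \<inter> {U. U \<in> T} = {U \<in> T. U \<in> S}"
    by auto
  finally show ?thesis .
qed

text \<open>A hyperplane not containing \<open>K\<close> misses \<open>[e + 1] = q^e + [e]\<close>
  members of \<open>D e\<close>; one containing \<open>K\<close> misses \<open>q^e\<close> or none.
  The surplus \<open>[e]\<close> adds up to \<open>M [h]\<close> and is cancelled by a correction
  that only hyperplanes not containing \<open>K\<close> notice. So \<open>E\<close> is full if
  \<open>K\<close> is outside \<open>H\<close>, and otherwise collects the \<open>e\<close> with
  \<open>W e\<close> outside \<open>H\<close>.\<close>

lemma ex_virtual_system:
  fixes b :: "nat \<Rightarrow> int"
  defines "q \<equiv> CARD('a::{field,finite})" and "r \<equiv> CARD('n::finite)"
  assumes h: "1 \<le> h" "h < r" and M: "M * int (qnum q h) = (\<Sum>e\<le>r - h. b e * int (qnum q e))"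
  obtains a :: "('a::{field,finite} ^ 'n::finite) set \<Rightarrow> int" where
    "virtual_system h a" "(\<Sum>U\<in>UNIV. a U) = (\<Sum>e\<le>r - h. b e * int q ^ e) + M"
    "\<And>H. hyperplane H \<Longrightarrow>
      \<exists>E\<subseteq>{..r - h}. r - h \<in> E \<and> missing a H = (\<Sum>e\<in>E. b e * int q ^ e)"
proof -
  obtain K :: "('a ^ 'n) set" where K: "vec.subspace K" "vec.dim K = h - 1"
    using obtain_subspace_of_dim[where 'n='n and 'a='a and m="h - 1"] h unfolding r_def
    by (metis diff_le_self le_trans less_imp_le)
  have "\<exists>W. vec.subspace W \<and> K \<subseteq> W \<and> vec.dim W = h + e" if "e \<le> r - h" for e
  proof (rule subspace_between[of K UNIV "h + e"])
    show "vec.dim K \<le> h + e" "h + e \<le> vec.dim (UNIV :: ('a ^ 'n) set)"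
      using K that h by (auto simp: r_def vec_dim_card card_cart_basis)
  qed (use K in auto)
  then obtain W where W: "\<And>e. e \<le> r - h \<Longrightarrow> vec.subspace (W e)"
    "\<And>e. e \<le> r - h \<Longrightarrow> K \<subseteq> W e" "\<And>e. e \<le> r - h \<Longrightarrow> vec.dim (W e) = h + e"
    by metis
  have dimW: "vec.dim (W e) = vec.dim K + Suc e" if "e \<le> r - h" for e
    using K W(3)[OF that] h by simp
  have one: "1 \<le> r - h"
    using h by simp
  define D where "D e = covers K (W e)" for e
  define G where "G = facets (W 1)"
  \<comment> \<open>The correction, \<open>[h]\<close> times \<open>D 1\<close> minus the facets of
    \<open>W 1\<close>, has missing number \<open>[h] (q + 1) - q [h] = [h]\<close> if
    \<open>K\<close> is outside the hyperplane and 0 otherwise.\<close>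
  define a where "a U = (\<Sum>e\<le>r - h. b e * of_bool (U \<in> D e)) -
    M * (int (qnum q h) * of_bool (U \<in> D 1) - of_bool (U \<in> G))" for U
  have sum_a: "(\<Sum>U\<in>S. a U) = (\<Sum>e\<le>r - h. b e * int (card {U \<in> D e. U \<in> S})) -
      M * (int (qnum q h) * int (card {U \<in> D 1. U \<in> S}) - int (card {U \<in> G. U \<in> S}))" for S
    unfolding a_def sum_subtractf sum_distrib_left[symmetric] sum.swap[of _ _ S] sum_of_bool_mem
    by simp
  have sum_qnum_Suc: "(\<Sum>e\<le>r - h. b e * int (qnum q (Suc e))) =
      (\<Sum>e\<le>r - h. b e * int (qnum q e)) + (\<Sum>e\<le>r - h. b e * int q ^ e)"
    by (simp add: qnum_Suc' sum.distrib algebra_simps)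
  have "virtual_system h a"
    unfolding virtual_system_def
  proof (intro allI impI)
    fix U assume "a U \<noteq> 0"
    have "(\<exists>e\<le>r - h. U \<in> D e) \<or> U \<in> D 1 \<or> U \<in> G"
    proof (rule ccontr)
      assume "\<not> ?thesis"
      then have "(\<Sum>e\<le>r - h. b e * of_bool (U \<in> D e)) = 0" "U \<notin> D 1" "U \<notin> G"
        by (auto intro!: sum.neutral)
      then show False
        using \<open>a U \<noteq> 0\<close> by (simp add: a_def)
    qed
    then show "vec.subspace U \<and> vec.dim U = h"
      using K W one h unfolding D_def G_def by (auto simp: covers_def facets_def)
  qed
  moreover have "(\<Sum>U\<in>UNIV. a U) = (\<Sum>e\<le>r - h. b e * int q ^ e) + M"
  proof -
    have "(\<Sum>U\<in>UNIV. a U) = (\<Sum>e\<le>r - h. b e * int (qnum q (Suc e))) -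
        M * (int (qnum q h) * (int q + 1) - int (qnum q (Suc h)))"
      unfolding sum_a
      using one W card_covers[OF K(1) W(1,2) dimW] card_facets[OF W(1)[OF one]]
      by (simp add: D_def G_def qnum_Suc flip: q_def)
    \<comment> \<open>By \<open>[h + 1] = 1 + q [h]\<close> the correction has total multiplicity
      \<open>[h] - 1\<close>; the hypothesis on \<open>M\<close> then cancels
      \<open>M [h]\<close>.\<close>
    also have "\<dots> = (\<Sum>e\<le>r - h. b e * int (qnum q e)) + (\<Sum>e\<le>r - h. b e * int q ^ e) - 
        M * (int (qnum q h) - 1)"
      unfolding sum_qnum_Suc qnum_Suc[of q h] by (simp add: algebra_simps)
    also have "\<dots> = (\<Sum>e\<le>r - h. b e * int q ^ e) + M"
      using M by (simp add: algebra_simps)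
    finally show ?thesis .
  qed
  moreover have "\<exists>E\<subseteq>{..r - h}. r - h \<in> E \<and> missing a H = (\<Sum>e\<in>E. b e * int q ^ e)"
    if H: "hyperplane H" for H
  proof -
    have cD: "card {U \<in> D e. \<not> U \<subseteq> H} =
        (if \<not> K \<subseteq> H then qnum q (Suc e) else if W e \<subseteq> H then 0 else q ^ e)" if "e \<le> r - h" for e
      using card_covers_Collect[OF K(1) W(1,2) dimW H] that by (simp add: D_def q_def)
    have cG: "card {U \<in> G. \<not> U \<subseteq> H} = (if W 1 \<subseteq> H then 0 else q * qnum q h)"
      using card_facets_Collect[OF W(1)[OF one] _ H, of h] W(3)[OF one] by (simp add: G_def q_def)
    have mis: "missing a H = (\<Sum>e\<le>r - h. b e * int (card {U \<in> D e. \<not> U \<subseteq> H})) -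
      M * (int (qnum q h) * int (card {U \<in> D 1. \<not> U \<subseteq> H}) - int (card {U \<in> G. \<not> U \<subseteq> H}))"
      unfolding missing_def sum_a by simp
    show ?thesis
    proof (cases "K \<subseteq> H")
      case False
      then have "\<not> W 1 \<subseteq> H"
        using W(2)[OF one] by blast
      then have "missing a H = (\<Sum>e\<le>r - h. b e * int (qnum q (Suc e))) - M * int (qnum q h)"
        unfolding mis using False cD one by (simp add: cG qnum_Suc algebra_simps)
      also have "\<dots> = (\<Sum>e\<le>r - h. b e * int q ^ e)"
        using M sum_qnum_Suc by simp
      finally show ?thesis
        by (intro exI[of _ "{..r - h}"]) simp
    next
      case True
      let ?E = "{e \<in> {..r - h}. \<not> W e \<subseteq> H}"
      have "missing a H = (\<Sum>e\<le>r - h. b e * int (if W e \<subseteq> H then 0 else q ^ e))"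
        unfolding mis using True cD one by (simp add: cG)
      also have "\<dots> = (\<Sum>e\<le>r - h. if \<not> W e \<subseteq> H then b e * int q ^ e else 0)"
        by (intro sum.cong) auto
      also have "\<dots> = (\<Sum>e\<in>?E. b e * int q ^ e)"
        by (rule sum.inter_filter[symmetric]) simp
      finally have "missing a H = (\<Sum>e\<in>?E. b e * int q ^ e)" .
      \<comment> \<open>\<open>W (r - h)\<close> has the full dimension \<open>r\<close>.\<close>
      moreover have "\<not> W (r - h) \<subseteq> H"
      proof
        assume "W (r - h) \<subseteq> H"
        then have "vec.dim (W (r - h)) \<le> vec.dim H"
          by (rule vec.dim_subset)
        then show False
          using H h W(3)[of "r - h"] by (simp add: hyperplane_def r_def)
      qed
      ultimately show ?thesis
        by (intro exI[of _ ?E]) auto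
    qed
  qed
  ultimately show ?thesis
    by (rule that)
qed

section \<open>Systems with constant missing number\<close>

text \<open>Here \<open>y U\<close> is the number of complete flags ending in \<open>U\<close>,
  built up dimension by dimension. The missing number is given multiplied by \<open>[r]\<close> to
  avoid a fraction.\<close>

lemma ex_dominating_system:
  defines "q \<equiv> CARD('a::{field,finite})" and "r \<equiv> CARD('n::finite)"
  assumes "k \<le> r"
  shows "\<exists>y :: ('a::{field,finite} ^ 'n::finite) set \<Rightarrow> int. virtual_system k y \<and>
    (\<forall>U. vec.subspace U \<and> vec.dim U = k \<longrightarrow> 1 \<le> y U) \<and> (\<forall>U. 0 \<le> y U) \<and>
    (\<forall>H. hyperplane H \<longrightarrow>
      missing y H * int (qnum q r) = (\<Sum>U\<in>UNIV. y U) * int q ^ (r - k) * int (qnum q k))"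
  using assms(3)
proof (induction k)
  case 0
  let ?y = "\<lambda>U :: ('a ^ 'n) set. of_bool (U = {0}) :: int"
  have "virtual_system 0 ?y"
    by (auto simp: virtual_system_def vec.subspace_single_0)
  moreover have "1 \<le> ?y U" if "vec.subspace U \<and> vec.dim U = 0" for U
    using that vec.subspace_0[of U] by auto
  moreover have "missing ?y H = 0" if "hyperplane H" for H
    using that vec.subspace_0[of H] by (auto simp: missing_def hyperplane_def intro!: sum.neutral)
  ultimately show ?case
    by (intro exI[of _ ?y]) auto
next
  case (Suc k)
  then obtain y :: "('a ^ 'n) set \<Rightarrow> int" where y: "virtual_system k y"
    "\<And>U. vec.subspace U \<Longrightarrow> vec.dim U = k \<Longrightarrow> 1 \<le> y U" "\<And>U. 0 \<le> y U"
    "\<And>H. hyperplane H \<Longrightarrow>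
      missing y H * int (qnum q r) = (\<Sum>U\<in>UNIV. y U) * int q ^ (r - k) * int (qnum q k)"
    by auto
  obtain m where m: "r = k + Suc m"
    using Suc.prems by (metis Suc_le_D add_Suc_shift le_iff_add)
  \<comment> \<open>Every flag ending in \<open>K\<close> is extended by each cover of
    \<open>K\<close>.\<close>
  define z where "z U = (\<Sum>K\<in>UNIV. y K * of_bool (U \<in> covers K UNIV))" for U
  have sum_z: "(\<Sum>U\<in>S. z U) = (\<Sum>K\<in>UNIV. y K * int (card {U \<in> covers K UNIV. U \<in> S}))" for S
    unfolding z_def sum.swap[of _ _ S] sum_distrib_left[symmetric] sum_of_bool_mem by simp
  have K: "vec.subspace K" "vec.dim (UNIV :: ('a ^ 'n) set) = vec.dim K + Suc m" "vec.dim K = k"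
    if "y K \<noteq> 0" for K
    using y(1) that m by (auto simp: virtual_system_def vec_dim_card card_cart_basis r_def)
  have "virtual_system (Suc k) z"
    unfolding virtual_system_def
  proof (intro allI impI)
    fix U assume "z U \<noteq> 0"
    then obtain K' where "y K' * of_bool (U \<in> covers K' UNIV) \<noteq> 0"
      unfolding z_def by (meson sum.not_neutral_contains_not_neutral)
    then show "vec.subspace U \<and> vec.dim U = Suc k"
      using K(3)[of K'] by (auto simp: covers_def)
  qed
  moreover have "1 \<le> z U" if U: "vec.subspace U" "vec.dim U = Suc k" for U
  proof -
    obtain K' where K': "vec.subspace K'" "K' \<subseteq> U" "vec.dim K' = k"
      using subspace_between[of "{0}" U k] U by (auto simp: vec.subspace_0)
    then have "1 \<le> y K' * of_bool (U \<in> covers K' UNIV)"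
      using U y(2)[of K'] by (simp add: covers_def)
    also have "\<dots> \<le> z U"
      unfolding z_def by (rule member_le_sum) (auto simp: y(3))
    finally show ?thesis .
  qed
  moreover have "0 \<le> z U" for U
    unfolding z_def by (intro sum_nonneg) (auto simp: y(3))
  moreover have "missing z H * int (qnum q r) =
      (\<Sum>U\<in>UNIV. z U) * int q ^ (r - Suc k) * int (qnum q (Suc k))" if H: "hyperplane H" for H
  proof -
    let ?s = "\<Sum>U\<in>UNIV. y U"
    have "(\<Sum>U\<in>UNIV. z U) = (\<Sum>K\<in>UNIV. y K * int (qnum q (Suc m)))"
      unfolding sum_z
    proof (intro sum.cong refl)
      fix K' :: "('a ^ 'n) set"
      show "y K' * int (card {U \<in> covers K' UNIV. U \<in> UNIV}) = y K' * int (qnum q (Suc m))"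
        using K[of K'] card_covers[of K' UNIV "Suc m"]
        by (cases "y K' = 0") (auto simp: q_def vec.subspace_UNIV)
    qed
    then have size: "(\<Sum>U\<in>UNIV. z U) = ?s * int (qnum q (Suc m))"
      by (simp add: sum_distrib_right)
    have nH: "\<not> UNIV \<subseteq> H"
      using H by (auto simp: hyperplane_def vec_dim_card card_cart_basis dest: top.extremum_uniqueI)
    \<comment> \<open>By \<open>[m + 1] = q^m + [m]\<close>, each \<open>K\<close> contributes
      \<open>q^m\<close> missed covers, and \<open>[m]\<close> more if \<open>K\<close> itself is
      outside \<open>H\<close>.\<close>
    have "missing z H = (\<Sum>K\<in>UNIV. y K * int q ^ m + (if \<not> K \<subseteq> H then y K * int (qnum q m) else 0))"
      unfolding missing_def sum_z
    proof (intro sum.cong refl)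
      fix K' :: "('a ^ 'n) set"
      show "y K' * int (card {U \<in> covers K' UNIV. U \<in> {U. \<not> U \<subseteq> H}}) =
          y K' * int q ^ m + (if \<not> K' \<subseteq> H then y K' * int (qnum q m) else 0)"
        using K[of K'] card_covers_Collect[of K' UNIV "Suc m" H] nH H
        by (cases "y K' = 0") (auto simp: q_def vec.subspace_UNIV qnum_Suc' algebra_simps)
    qed
    also have "\<dots> = ?s * int q ^ m + missing y H * int (qnum q m)"
      by (simp add: sum.distrib sum_distrib_right missing_def sum.If_cases)
    finally have "missing z H * int (qnum q r) =
        ?s * int q ^ m * int (qnum q r) + int (qnum q m) * (missing y H * int (qnum q r))"
      by (simp add: algebra_simps)
    also have "\<dots> = ?s * int q ^ m * (int (qnum q r) + int q * int (qnum q k) * int (qnum q m))"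
      using y(4)[OF H] m by (simp add: algebra_simps)
    also have "int (qnum q r) + int q * int (qnum q k) * int (qnum q m) =
        int (qnum q (Suc m)) * int (qnum q (Suc k))"
    proof -
      have "qnum q r = qnum q (Suc m) + q ^ Suc m * qnum q k"
        using m qnum_add[of q "Suc m" k] by (simp add: add.commute)
      then show ?thesis
        by (simp add: qnum_Suc[of q k]) (simp add: qnum_Suc' algebra_simps)
    qed
    finally show ?thesis
      using size m by (simp add: algebra_simps)
  qed
  ultimately show ?case
    by (intro exI[of _ z]) simp
qed

subsection \<open>Existence of large systems\<close>

text \<open>Start from \<open>d\<close> tokens of value 1 and repeatedly merge \<open>q\<close>
  equal tokens into one. A token of value \<open>q^e\<close> costs \<open>[e]\<close> merges. With
  values up to \<open>q^m\<close> the sum of the quotients is the maximal number of merges, and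
  stopping early realises every smaller \<open>v\<close>.\<close>

lemma ex_exponents:
  fixes q d v :: nat
  assumes "q \<ge> 1" "v \<le> (\<Sum>j=1..m. d div q ^ j)"
  shows "\<exists>\<epsilon> :: nat \<Rightarrow> nat. (\<Sum>e\<le>m. \<epsilon> e * q ^ e) = d \<and> (\<Sum>e\<le>m. \<epsilon> e * qnum q e) = v"
  using assms(2)
proof (induction m arbitrary: d v)
  case 0
  then show ?case
    by (intro exI[of _ "\<lambda>_. d"]) simp
next
  case (Suc m)
  \<comment> \<open>\<open>d'\<close> merges happen on the lowest level; the other \<open>v'\<close>
    happen among the \<open>d'\<close> new tokens, by induction.\<close>
  define d' where "d' = min v (d div q)"
  define v' where "v' = v - d'"
  have "(\<Sum>j=1..Suc m. d div q ^ j) = d div q + (\<Sum>j=1..m. (d div q) div q ^ j)"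
    by (subst sum.atLeast_Suc_atMost)
      (simp_all add: sum.shift_bounds_cl_Suc_ivl div_mult2_eq del: sum.cl_ivl_Suc)
  then have "v' \<le> (\<Sum>j=1..m. d' div q ^ j)"
    using Suc.prems by (auto simp: v'_def d'_def min_def)
  then obtain \<eta> where \<eta>: "(\<Sum>e\<le>m. \<eta> e * q ^ e) = d'" "(\<Sum>e\<le>m. \<eta> e * qnum q e) = v'"
    using Suc.IH by blast
  define \<epsilon> where "\<epsilon> = case_nat (d - q * d') \<eta>"
  have "q * d' \<le> d"
    unfolding d'_def using times_div_less_eq_dividend[of q d]
    by (meson le_trans min.cobounded2 mult_le_mono2)
  moreover have "(\<Sum>e\<le>Suc m. \<epsilon> e * q ^ e) = (d - q * d') + q * (\<Sum>e\<le>m. \<eta> e * q ^ e)"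
    by (subst sum.atMost_Suc_shift) (simp add: \<epsilon>_def sum_distrib_left algebra_simps)
  moreover have "(\<Sum>e\<le>Suc m. \<epsilon> e * qnum q e) = v' + d'"
    by (subst sum.atMost_Suc_shift)
      (simp add: \<epsilon>_def qnum_Suc' sum.distrib algebra_simps flip: \<eta>)
  moreover have "v' + d' = v"
    by (simp add: v'_def d'_def)
  ultimately show ?case
    using \<eta> by (intro exI[of _ \<epsilon>]) simp
qed

section \<open>From integer multiplicities to multisets\<close>

lemma size_eq_sum_count:
  fixes M :: "'b::finite multiset"
  shows "size M = (\<Sum>x\<in>UNIV. count M x)"
  unfolding size_multiset_overloaded_eq
  by (rule sum.mono_neutral_left) (auto simp: count_eq_zero_iff)

lemma contained_count_eq_sum:
  fixes S :: "'v::finite set multiset"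
  shows "contained_count S H = (\<Sum>U | U \<subseteq> H. count S U)"
proof -
  have "contained_count S H = (\<Sum>U\<in>UNIV. if U \<subseteq> H then count S U else 0)"
    by (simp add: contained_count_def size_eq_sum_count)
  then show ?thesis
    by (simp add: sum.If_cases)
qed

lemma sum_eq_missing:
  fixes a :: "'v::finite set \<Rightarrow> int"
  shows "(\<Sum>U\<in>UNIV. a U) = (\<Sum>U | U \<subseteq> H. a U) + missing a H"
proof -
  have "UNIV = {U. U \<subseteq> H} \<union> {U. \<not> U \<subseteq> H}"
    by auto
  then have "sum a UNIV = sum a ({U. U \<subseteq> H} \<union> {U. \<not> U \<subseteq> H})"
    by metis
  also have "\<dots> = (\<Sum>U | U \<subseteq> H. a U) + missing a H"
    unfolding missing_def by (rule sum.union_disjoint) auto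
  finally show ?thesis .
qed

text \<open>The bound \<open>s\<close> on the hyperplane counts becomes sharp after adding copies of the zero subspace.\<close>

lemma ex_projective_system:
  fixes S :: "('a::{field,finite} ^ 'n::finite) set multiset"
  assumes "\<And>U. U \<in># S \<Longrightarrow> vec.subspace U \<and> vec.dim U \<le> h"
    and "\<And>H. hyperplane H \<Longrightarrow> contained_count S H \<le> s"
  shows "\<exists>n\<ge>size S. \<exists>S' :: ('a ^ 'n) set multiset. projective_system h n s S'"
proof -
  let ?C = "contained_count S ` {H. hyperplane H}"
  obtain H0 :: "('a ^ 'n) set" where H0: "vec.subspace H0" "vec.dim H0 = CARD('n) - 1"
    using obtain_subspace_of_dim[where 'n='n and 'a='a and m="CARD('n) - 1"] by auto
  then have "hyperplane H0"
    by (simp add: hyperplane_def)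
  then have "Max ?C \<in> ?C"
    by (intro Max_in) auto
  then obtain H where H: "hyperplane H" "contained_count S H = Max ?C"
    by auto
  define x where "x = s - Max ?C"
  define S' where "S' = S + replicate_mset x {0}"
  have x: "Max ?C + x = s"
    using H assms(2)[of H] by (simp add: x_def)
  have count: "contained_count S' H' = contained_count S H' + x" if "hyperplane H'" for H'
  proof -
    have "{0} \<subseteq> H'"
      using that vec.subspace_0[of H'] by (simp add: hyperplane_def)
    then have "size {#U \<in># replicate_mset x {0}. U \<subseteq> H'#} = x"
      by (induction x) simp_all
    then show ?thesis
      by (simp add: S'_def contained_count_def)
  qed
  have "projective_system h (size S + x) s S'"
    unfolding projective_system_def
  proof (intro conjI allI impI ballI exI[of _ H])
    show "contained_count S' H' \<le> s" if "hyperplane H'" for H'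
    proof -
      have "contained_count S H' \<le> Max ?C"
        using that by (intro Max_ge) auto
      then show ?thesis
        using x count[OF that] by linarith
    qed
    show "contained_count S' H = s"
      using count H x by simp
  qed (use assms(1) H in \<open>auto simp: S'_def vec.subspace_single_0 split: if_splits\<close>)
  then show ?thesis
    by (intro exI[of _ "size S + x"]) auto
qed

text \<open>For \<open>t = T + m Y\<close> with \<open>T < Y\<close> the system is
  \<open>a + T b + m B y\<close>. Both \<open>b\<close> and \<open>y\<close> have missing number and
  size in the ratio \<open>B - A\<close> to \<open>B\<close> for every hyperplane; \<open>b\<close>
  adjusts the residue of \<open>t\<close>, and \<open>y\<close> outweighs the bounded negative part
  of \<open>a + T b\<close> once \<open>m\<close> is large.\<close>

lemma ex_system_of_virtual_system:
  fixes a :: "('a::{field,finite} ^ 'n::finite) set \<Rightarrow> int"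
  defines "q \<equiv> CARD('a)" and "r \<equiv> CARD('n)"
  assumes h: "1 \<le> h" "h < r"
    and A: "A * qnum q h = qnum q (r - h)" and B: "B * qnum q h = qnum q r"
    and a: "virtual_system h a" "(\<Sum>U\<in>UNIV. a U) = - int (i + d)"
      "\<And>H. hyperplane H \<Longrightarrow> - int d \<le> missing a H"
  shows "\<exists>t\<^sub>0. \<forall>t\<ge>t\<^sub>0. \<exists>S :: ('a ^ 'n) set multiset.
    int (size S) = int B * int t - int (i + d) \<and>
    (\<forall>U\<in>#S. vec.subspace U \<and> vec.dim U = h) \<and>
    (\<forall>H. hyperplane H \<longrightarrow> int (contained_count S H) \<le> int A * int t - int i)"
proof -
  have q: "1 < q"
    unfolding q_def by (rule card_field_gt_1)
  have h_pos: "0 < qnum q h"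
    using h by (cases h) (simp_all add: qnum_Suc)
  have "qnum q r = qnum q (r - h) + q ^ (r - h) * qnum q h"
    using h qnum_add[of q "r - h" h] by simp
  then have "B * qnum q h = (A + q ^ (r - h)) * qnum q h"
    using A B by (simp add: algebra_simps)
  then have BA: "B = A + q ^ (r - h)"
    using h_pos by simp
  then have B_pos: "1 \<le> B"
    using q one_le_power[of q "r - h"] by linarith
  \<comment> \<open>For \<open>b\<close> only the top coefficient is 1, which forces
    \<open>M = A\<close> and total \<open>q^(r - h) + A = B\<close>.\<close>
  have "int A * int (qnum q h) = (\<Sum>e\<le>r - h. of_bool (e = r - h) * int (qnum q e))"
    using A by (simp flip: of_nat_mult)
  then obtain b :: "('a ^ 'n) set \<Rightarrow> int" where b: "virtual_system h b"
    "(\<Sum>U\<in>UNIV. b U) = (\<Sum>e\<le>r - h. of_bool (e = r - h) * int q ^ e) + int A"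
    "\<And>H. hyperplane H \<Longrightarrow> \<exists>E\<subseteq>{..r - h}. r - h \<in> E \<and>
      missing b H = (\<Sum>e\<in>E. of_bool (e = r - h) * int q ^ e)"
    by (rule ex_virtual_system[OF h[unfolded r_def], where 'a='a, folded q_def r_def]) (rule that)
  have b_size: "(\<Sum>U\<in>UNIV. b U) = int B"
    using b(2) BA by simp
  \<comment> \<open>Whatever \<open>E\<close> is, it contains \<open>r - h\<close>, the only index
    with a nonzero term.\<close>
  have b_missing: "missing b H = int B - int A" if H: "hyperplane H" for H
  proof -
    obtain E where E: "E \<subseteq> {..r - h}" "r - h \<in> E"
      "missing b H = (\<Sum>e\<in>E. of_bool (e = r - h) * int q ^ e)"
      using b(3)[OF H] by blast
    have "finite E"
      using E(1) finite_subset by blast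
    then have "(\<Sum>e\<in>E. of_bool (e = r - h) * int q ^ e) = int q ^ (r - h)"
      using E(2) by (subst sum.remove[of E "r - h"]) (auto intro!: sum.neutral)
    then show ?thesis
      using E BA by simp
  qed
  obtain y :: "('a ^ 'n) set \<Rightarrow> int" where y: "virtual_system h y"
    "\<And>U. vec.subspace U \<Longrightarrow> vec.dim U = h \<Longrightarrow> 1 \<le> y U" "\<And>U. 0 \<le> y U"
    "\<And>H. hyperplane H \<Longrightarrow>
      missing y H * int (qnum q r) = (\<Sum>U\<in>UNIV. y U) * int q ^ (r - h) * int (qnum q h)"
    using ex_dominating_system[where 'a='a and 'n='n and k=h] h unfolding q_def r_def
    by (metis less_imp_le)
  define Y where "Y = nat (\<Sum>U\<in>UNIV. y U)"
  have Y: "(\<Sum>U\<in>UNIV. y U) = int Y"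
    by (simp add: Y_def y(3) sum_nonneg)
  have y_missing: "missing y H * int B = int Y * (int B - int A)" if "hyperplane H" for H
  proof -
    have "missing y H * int (qnum q r) = int Y * int q ^ (r - h) * int (qnum q h)"
      using y(4)[OF that] Y by simp
    then have "(missing y H * int B) * int (qnum q h) = (int Y * (int B - int A)) * int (qnum q h)"
      using BA by (simp flip: B add: algebra_simps)
    then show ?thesis
      using h_pos by simp
  qed
  have Y_pos: "0 < Y"
  proof -
    obtain U :: "('a ^ 'n) set" where "vec.subspace U" "vec.dim U = h"
      using obtain_subspace_of_dim[where 'n='n and 'a='a and m=h] h
      unfolding r_def by (metis less_imp_le)
    then have "1 \<le> y U"
      by (rule y(2))
    also have "\<dots> \<le> int Y"
      unfolding Y[symmetric] by (rule member_le_sum) (auto simp: y(3))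
    finally show ?thesis
      by simp
  qed
  \<comment> \<open>\<open>C\<close> bounds the negative multiplicities of \<open>a + T b\<close>
    for all \<open>T \<le> Y\<close>, independently of \<open>t\<close>.\<close>
  define C where "C = nat (\<Sum>U\<in>UNIV. \<bar>a U\<bar> + int Y * \<bar>b U\<bar>)"
  have C: "\<bar>a U\<bar> + int Y * \<bar>b U\<bar> \<le> int C" for U
  proof -
    have "\<bar>a U\<bar> + int Y * \<bar>b U\<bar> \<le> (\<Sum>U\<in>UNIV. \<bar>a U\<bar> + int Y * \<bar>b U\<bar>)"
      by (rule member_le_sum) auto
    then show ?thesis
      by (simp add: C_def)
  qed
  show ?thesis
  proof (intro exI[of _ "Y * C"] allI impI)
    fix t assume t: "Y * C \<le> t"
    define T m where "T = t mod Y" and "m = t div Y"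
    have tT: "int t = int T + int m * int Y"
      by (simp add: T_def m_def flip: of_nat_mult of_nat_add)
    have m: "C \<le> m"
      using t Y_pos by (simp add: m_def less_eq_div_iff_mult_less_eq mult.commute)
    define f where "f U = a U + int T * b U + int m * int B * y U" for U
    have f_supp: "f U = 0" if "\<not> (vec.subspace U \<and> vec.dim U = h)" for U
    proof -
      have "a U = 0" "b U = 0" "y U = 0"
        using that a(1) b(1) y(1) unfolding virtual_system_def by blast+
      then show ?thesis
        by (simp add: f_def)
    qed
    have f_nonneg: "0 \<le> f U" for U
    proof (cases "vec.subspace U \<and> vec.dim U = h")
      case True
      have "int C \<le> int m * int B * y U"
      proof -
        have "int C * 1 * 1 \<le> int m * int B * y U"
          using m B_pos y(2)[of U] True by (intro mult_mono) auto
        then show ?thesis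
          by simp
      qed
      moreover have "\<bar>int T * b U\<bar> \<le> int Y * \<bar>b U\<bar>"
        using Y_pos by (simp add: abs_mult T_def mult_right_mono less_imp_le)
      ultimately show ?thesis
        using C[of U] unfolding f_def by linarith
    qed (use f_supp in simp)
    define S where "S = (\<Sum>U\<in>UNIV. replicate_mset (nat (f U)) U)"
    have count: "count S U = nat (f U)" for U
      by (simp add: S_def count_sum)
    have sum_f: "sum f X = sum a X + int T * sum b X + int m * int B * sum y X" for X
      by (simp add: f_def sum.distrib sum_distrib_left)
    have size: "(\<Sum>U\<in>UNIV. f U) = int B * int t - int (i + d)"
      unfolding sum_f a(2) b_size Y tT by (simp add: algebra_simps)
    have "int (size S) = int B * int t - int (i + d)"
      using size by (simp add: size_eq_sum_count count f_nonneg)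
    moreover have "vec.subspace U \<and> vec.dim U = h" if "U \<in># S" for U
    proof (rule ccontr)
      assume "\<not> ?thesis"
      then have "count S U = 0"
        by (simp add: count f_supp)
      then show False
        using that by (simp add: count_eq_zero_iff)
    qed
    moreover have "int (contained_count S H) \<le> int A * int t - int i" if H: "hyperplane H" for H
    proof -
      have "int (contained_count S H) = (\<Sum>U\<in>UNIV. f U) - missing f H"
        unfolding sum_eq_missing[of f H] by (simp add: contained_count_eq_sum count f_nonneg)
      moreover have "missing f H =
          missing a H + int T * missing b H + int m * (missing y H * int B)"
        by (simp add: missing_def sum_f algebra_simps)
      then have "missing f H = missing a H + int T * (int B - int A) +
          int m * (int Y * (int B - int A))"
        by (simp only: b_missing[OF H] y_missing[OF H])
      \<comment> \<open>The missing number is at least \<open>(B - A) t - d\<close>; taking it from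
        the size leaves at most \<open>A t - i\<close>.\<close>
      ultimately show ?thesis
        using a(3)[OF H] size tT by (simp add: algebra_simps)
    qed
    ultimately show "\<exists>S :: ('a ^ 'n) set multiset.
      int (size S) = int B * int t - int (i + d) \<and>
      (\<forall>U\<in>#S. vec.subspace U \<and> vec.dim U = h) \<and>
      (\<forall>H. hyperplane H \<longrightarrow> int (contained_count S H) \<le> int A * int t - int i)"
      by blast
  qed
qed

text \<open>Split \<open>d\<close> into \<epsilon>-many powers of \<open>q\<close> whose merge count
  is \<open>i [h]\<close>. Negated, they serve as coefficients with \<open>M = - i\<close>, so the
  total is \<open>- (i + d)\<close>; the missing numbers are negated partial sums of the splitting,
  hence at least \<open>- d\<close>.\<close>

lemma ex_large_system:
  defines "q \<equiv> CARD('a::{field,finite})" and "r \<equiv> CARD('n::finite)"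
  assumes h: "1 \<le> h" "h < r"
    and A: "A * qnum q h = qnum q (r - h)" and B: "B * qnum q h = qnum q r"
    and le: "i * qnum q h \<le> (\<Sum>j=1..r - h. d div q ^ j)"
  shows "\<exists>t\<^sub>0. \<forall>t\<ge>t\<^sub>0. \<exists>S :: ('a::{field,finite} ^ 'n::finite) set multiset.
    int (size S) = int B * int t - int (i + d) \<and>
    (\<forall>U\<in>#S. vec.subspace U \<and> vec.dim U = h) \<and>
    (\<forall>H. hyperplane H \<longrightarrow> int (contained_count S H) \<le> int A * int t - int i)"
proof -
  have "1 < q"
    unfolding q_def by (rule card_field_gt_1)
  then obtain \<epsilon> :: "nat \<Rightarrow> nat" where
    \<epsilon>: "(\<Sum>e\<le>r - h. \<epsilon> e * q ^ e) = d" "(\<Sum>e\<le>r - h. \<epsilon> e * qnum q e) = i * qnum q h"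
    using ex_exponents[OF _ le] by auto
  have "- int i * int (qnum q h) = (\<Sum>e\<le>r - h. - int (\<epsilon> e) * int (qnum q e))"
    by (simp add: sum_negf flip: \<epsilon>(2) of_nat_mult of_nat_sum)
  then obtain a :: "('a ^ 'n) set \<Rightarrow> int" where a: "virtual_system h a"
    "(\<Sum>U\<in>UNIV. a U) = (\<Sum>e\<le>r - h. - int (\<epsilon> e) * int q ^ e) + - int i"
    "\<And>H. hyperplane H \<Longrightarrow> \<exists>E\<subseteq>{..r - h}. r - h \<in> E \<and>
      missing a H = (\<Sum>e\<in>E. - int (\<epsilon> e) * int q ^ e)"
    by (rule ex_virtual_system[OF h[unfolded r_def], where 'a='a, folded q_def r_def]) (rule that)
  have sum_d: "(\<Sum>e\<le>r - h. int (\<epsilon> e) * int q ^ e) = int d"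
    using arg_cong[OF \<epsilon>(1), of int] by simp
  have size: "(\<Sum>U\<in>UNIV. a U) = - int (i + d)"
    using a(2) sum_d by (simp add: sum_negf)
  have "- int d \<le> missing a H" if H: "hyperplane H" for H
  proof -
    obtain E where E: "E \<subseteq> {..r - h}" "missing a H = (\<Sum>e\<in>E. - int (\<epsilon> e) * int q ^ e)"
      using a(3)[OF H] by blast
    have "(\<Sum>e\<in>E. int (\<epsilon> e) * int q ^ e) \<le> (\<Sum>e\<le>r - h. int (\<epsilon> e) * int q ^ e)"
      using E(1) by (intro sum_mono2) auto
    then show ?thesis
      using E(2) sum_d by (simp add: sum_negf)
  qed
  then show ?thesis
    using ex_system_of_virtual_system[OF h[unfolded r_def] A[unfolded q_def r_def]
        B[unfolded q_def r_def] a(1) size]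
    by simp
qed

subsection \<open>The Griesmer bound\<close>

text \<open>The vectors of \<open>U\<close> in \<open>W - X\<close> are partitioned by the covers of
  \<open>X\<close>, and a \<open>k\<close>-space has \<open>1 + (q - 1) [k]\<close> vectors. There
  are \<open>q + 1\<close> covers, so the term of \<open>X\<close> is counted \<open>q\<close> extra
  times.\<close>

lemma sum_covers_qnum_dim:
  fixes U W X :: "('a::{field,finite} ^ 'n::finite) set"
  assumes "vec.subspace U" "vec.subspace W" "vec.subspace X" "X \<subseteq> W" "vec.dim W = vec.dim X + 2"
  shows "(\<Sum>Y\<in>covers X W. int (qnum CARD('a) (vec.dim (U \<inter> Y)))) =
    int (qnum CARD('a) (vec.dim (U \<inter> W))) + int CARD('a) * int (qnum CARD('a) (vec.dim (U \<inter> X)))"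
proof -
  let ?q = "CARD('a)" and ?f = "\<lambda>Z. int (qnum CARD('a) (vec.dim (U \<inter> Z)))"
  have q: "1 < ?q"
    by (rule card_field_gt_1)
  have card: "int (card (U \<inter> Z)) = 1 + (int ?q - 1) * ?f Z" if "vec.subspace Z" for Z
    using card_subspace[of "U \<inter> Z"] that assms(1) power_eq_qnum[of ?q "vec.dim (U \<inter> Z)"] q
    by (simp add: vec.subspace_inter of_nat_diff)
  have diff: "int (card (U \<inter> (Z - X))) = (int ?q - 1) * (?f Z - ?f X)"
    if "vec.subspace Z" "X \<subseteq> Z" for Z
  proof -
    have "U \<inter> (Z - X) = (U \<inter> Z) - (U \<inter> X)"
      by auto
    moreover have sub: "U \<inter> X \<subseteq> U \<inter> Z"
      using that by blast
    ultimately have "card (U \<inter> (Z - X)) = card (U \<inter> Z) - card (U \<inter> X)"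
      by (simp only: card_Diff_subset[OF finite sub])
    then have "int (card (U \<inter> (Z - X))) = int (card (U \<inter> Z)) - int (card (U \<inter> X))"
      using card_mono[OF finite sub] by (simp add: of_nat_diff)
    then show ?thesis
      using card[OF that(1)] card[OF assms(3)] by (simp add: algebra_simps)
  qed
  have "U \<inter> (W - X) = (\<Union>Y\<in>covers X W. U \<inter> (Y - X))"
    using Union_covers[OF assms(3,2,4)] by blast
  moreover have "card (\<Union>Y\<in>covers X W. U \<inter> (Y - X)) = (\<Sum>Y\<in>covers X W. card (U \<inter> (Y - X)))"
  proof (intro card_UN_disjoint ballI impI)
    fix Y Y' assume "Y \<in> covers X W" "Y' \<in> covers X W" "Y \<noteq> Y'"
    then show "U \<inter> (Y - X) \<inter> (U \<inter> (Y' - X)) = {}"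
      using covers_disjoint[OF assms(3)] by blast
  qed simp_all
  ultimately have "int (card (U \<inter> (W - X))) = (\<Sum>Y\<in>covers X W. int (card (U \<inter> (Y - X))))"
    by simp
  also have "\<dots> = (\<Sum>Y\<in>covers X W. (int ?q - 1) * (?f Y - ?f X))"
    by (intro sum.cong refl diff) (auto simp: covers_def)
  also have "\<dots> = (int ?q - 1) * ((\<Sum>Y\<in>covers X W. ?f Y) - int (card (covers X W)) * ?f X)"
    by (simp add: sum_subtractf flip: sum_distrib_left)
  also have "card (covers X W) = ?q + 1"
    using card_covers[of X W 2] assms by (simp add: qnum_Suc numeral_2_eq_2)
  finally have "(int ?q - 1) * (?f W - ?f X) =
      (int ?q - 1) * ((\<Sum>Y\<in>covers X W. ?f Y) - int (?q + 1) * ?f X)"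
    using diff[OF assms(2,4)] by simp
  then have "?f W - ?f X = (\<Sum>Y\<in>covers X W. ?f Y) - int (?q + 1) * ?f X"
    using q by simp
  then show ?thesis
    by (simp add: algebra_simps)
qed

text \<open>The number of incidences between elements of \<open>S\<close> and projective points of
  \<open>W\<close>, for subspaces.\<close>

definition point_weight :: "('a::{field,finite} ^ 'n) set multiset \<Rightarrow> ('a ^ 'n) set \<Rightarrow> int" where
  "point_weight S W = (\<Sum>U\<in>#S. int (qnum CARD('a) (vec.dim (U \<inter> W))))"

lemma point_weight_nonneg: "0 \<le> point_weight S W"
  unfolding point_weight_def by (induction S) auto

lemma sum_covers_point_weight:
  fixes W X :: "('a::{field,finite} ^ 'n::finite) set"
  assumes "\<And>U. U \<in># S \<Longrightarrow> vec.subspace U"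
    and "vec.subspace W" "vec.subspace X" "X \<subseteq> W" "vec.dim W = vec.dim X + 2"
  shows "(\<Sum>Y\<in>covers X W. point_weight S Y) = point_weight S W + int CARD('a) * point_weight S X"
  using assms(1)
proof (induction S)
  case (add U S)
  then show ?case
    using sum_covers_qnum_dim[of U W X] assms(2-)
    by (simp add: point_weight_def sum.distrib algebra_simps)
qed (simp add: point_weight_def)

text \<open>Let \<open>H\<close> be a heaviest facet and \<open>X\<close> a facet of
  \<open>H\<close>. The \<open>q + 1\<close> covers of \<open>X\<close> in \<open>W\<close> weigh at
  most as much as \<open>H\<close>, so \<open>w W - w H \<le> q (w H - w X)\<close> for the weight
  \<open>w\<close>. Thus \<open>H\<close> satisfies the hypothesis with \<open>e div q\<close> in
  place of \<open>e\<close>.\<close>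

lemma griesmer_bound:
  fixes S :: "('a::{field,finite} ^ 'n::finite) set multiset" and t e :: int
  defines "q \<equiv> CARD('a)"
  assumes S: "\<And>U. U \<in># S \<Longrightarrow> vec.subspace U"
    and "vec.subspace W" "vec.dim W = k"
    and "\<And>X. X \<in> facets W \<Longrightarrow>
      int q ^ (k - 1) * t - e \<le> point_weight S W - point_weight S X"
  shows "int (qnum q k) * t - (\<Sum>j<k. e div int q ^ j) \<le> point_weight S W"
  using assms(3-)
proof (induction k arbitrary: W e)
  case 0
  then show ?case
    by (simp add: point_weight_nonneg)
next
  case (Suc k)
  have q: "1 < q"
    unfolding q_def by (rule card_field_gt_1)
  have "card (facets W) \<noteq> 0"
    using card_facets[OF Suc.prems(1)] Suc.prems(2) by (simp add: qnum_Suc)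
  then have "facets W \<noteq> {}"
    by force
  then have "Max (point_weight S ` facets W) \<in> point_weight S ` facets W"
    by (intro Max_in) auto
  then obtain H where "H \<in> facets W" "point_weight S H = Max (point_weight S ` facets W)"
    by auto
  then have H: "H \<in> facets W" "\<And>Y. Y \<in> facets W \<Longrightarrow> point_weight S Y \<le> point_weight S H"
    by simp_all
  have H': "vec.subspace H" "H \<subseteq> W" "vec.dim H = k"
    using H(1) Suc.prems by (auto simp: facets_def)
  have "int q ^ (k - 1) * t - e div int q \<le> point_weight S H - point_weight S X"
    if X: "X \<in> facets H" for X
  proof -
    \<comment> \<open>\<open>k\<close> is positive because \<open>H\<close> has a facet, so
      \<open>k - 1\<close> is not truncated.\<close>
    have X': "vec.subspace X" "X \<subseteq> W" "vec.dim W = vec.dim X + 2" "k = Suc (k - 1)"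
      using X H' Suc.prems by (auto simp: facets_def)
    have le: "point_weight S Y \<le> point_weight S H" if "Y \<in> covers X W" for Y
      using that X' Suc.prems by (intro H(2)) (auto simp: covers_def facets_def)
    have "point_weight S W + int q * point_weight S X = (\<Sum>Y\<in>covers X W. point_weight S Y)"
      using sum_covers_point_weight[OF S _ X'(1-3)] Suc.prems(1) by (simp add: q_def)
    also have "\<dots> \<le> (\<Sum>Y\<in>covers X W. point_weight S H)"
      using le by (intro sum_mono)
    also have "\<dots> = (int q + 1) * point_weight S H"
      using card_covers[of X W 2] X' Suc.prems by (simp add: qnum_Suc numeral_2_eq_2 q_def)
    finally have "int q ^ k * t - e \<le> int q * (point_weight S H - point_weight S X)"
      using Suc.prems(3)[OF H(1)] by (simp add: algebra_simps)
    moreover have "int q ^ k = int q * int q ^ (k - 1)"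
      by (subst X'(4)) simp
    ultimately have "int q * (int q ^ (k - 1) * t - (point_weight S H - point_weight S X)) \<le> e"
      by (simp add: algebra_simps)
    \<comment> \<open>The left factor is an integer, so the quotient of \<open>e\<close> may be
      rounded down.\<close>
    then have "(int q * (int q ^ (k - 1) * t - (point_weight S H - point_weight S X))) div int q
        \<le> e div int q"
      using q by (intro zdiv_mono1) auto
    then show ?thesis
      using q by simp
  qed
  then have "int (qnum q k) * t - (\<Sum>j<k. e div int q div int q ^ j) \<le> point_weight S H"
    by (rule Suc.IH[OF H'(1,3)])
  moreover have "int q ^ k * t - e \<le> point_weight S W - point_weight S H"
    using Suc.prems(3)[OF H(1)] by simp
  moreover have "(\<Sum>j<Suc k. e div int q ^ j) = e + (\<Sum>j<k. e div int q div int q ^ j)"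
    by (subst sum.lessThan_Suc_shift) (simp add: zdiv_zmult2_eq)
  ultimately show ?case
    by (simp add: qnum_Suc' algebra_simps)
qed

lemma sum_lessThan_add:
  fixes f :: "nat \<Rightarrow> 'b::comm_monoid_add"
  shows "(\<Sum>j<a + b. f j) = (\<Sum>j<a. f j) + (\<Sum>j<b. f (a + j))"
  by (induction b) (simp_all add: add.assoc)

text \<open>For \<open>j < h\<close> the division is exact and these terms add up to
  \<open>[h] e\<close>; for larger exponents \<open>q^(h - 1)\<close> cancels and the floors of
  \<open>e\<close> remain.\<close>

lemma sum_div_power_shift:
  fixes q e :: int
  assumes "0 < q" "1 \<le> h"
  shows "(\<Sum>j<h + m. (q ^ (h - 1) * e) div q ^ j) = (\<Sum>j<h. q ^ j) * e + (\<Sum>j=1..m. e div q ^ j)"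
proof -
  have "(\<Sum>j<h. (q ^ (h - 1) * e) div q ^ j) = (\<Sum>j<h. q ^ (h - Suc j) * e)"
  proof (intro sum.cong refl)
    fix j assume "j \<in> {..<h}"
    then have "q ^ (h - 1) = q ^ j * q ^ (h - Suc j)"
      by (simp flip: power_add)
    then show "(q ^ (h - 1) * e) div q ^ j = q ^ (h - Suc j) * e"
      using assms by (simp add: mult.assoc)
  qed
  also have "\<dots> = (\<Sum>j<h. q ^ j) * e"
    unfolding sum_distrib_right[symmetric] by (simp only: sum.nat_diff_reindex)
  finally have "(\<Sum>j<h. (q ^ (h - 1) * e) div q ^ j) = (\<Sum>j<h. q ^ j) * e" .
  moreover have "(q ^ (h - 1) * e) div q ^ (h + j) = e div q ^ Suc j" for j
  proof -
    have "q ^ (h + j) = q ^ (h - 1) * q ^ Suc j"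
      using assms(2) by (simp flip: power_add power_Suc)
    then show ?thesis
      using assms by simp
  qed
  ultimately show ?thesis
    by (simp add: sum_lessThan_add sum.atLeast1_atMost_eq)
qed

text \<open>An \<open>h\<close>-space outside \<open>H\<close> meets it in dimension
  \<open>h - 1\<close> and so loses \<open>[h] - [h - 1] = q^(h - 1)\<close> points.\<close>

lemma point_weight_hyperplane:
  fixes S :: "('a::{field,finite} ^ 'n::finite) set multiset"
  assumes "\<And>U. U \<in># S \<Longrightarrow> vec.subspace U \<and> vec.dim U = h" "1 \<le> h" "hyperplane H"
  shows "point_weight S UNIV - point_weight S H =
    (int (size S) - int (contained_count S H)) * int CARD('a) ^ (h - 1)"
  using assms(1)
proof (induction S)
  case (add U S)
  have IH: "point_weight S UNIV - point_weight S H =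
    (int (size S) - int (contained_count S H)) * int CARD('a) ^ (h - 1)"
    using add by simp
  have U: "vec.subspace U" "vec.dim U = h"
    using add.prems by auto
  have h: "h = Suc (h - 1)"
    using assms(2) by simp
  show ?case
  proof (cases "U \<subseteq> H")
    case True
    then have "U \<inter> H = U"
      by blast
    then show ?thesis
      using IH True by (simp add: point_weight_def contained_count_def)
  next
    case False
    then have "vec.dim (U \<inter> H) = h - 1"
      using dim_Int_hyperplane[OF U(1) assms(3)] U by simp
    moreover have "qnum CARD('a) h = qnum CARD('a) (h - 1) + CARD('a) ^ (h - 1)"
      by (subst h) (simp only: qnum_Suc')
    ultimately show ?thesis
      using IH False U by (simp add: point_weight_def contained_count_def algebra_simps)
  qed
qed (simp add: point_weight_def contained_count_def)

section \<open>Upper bound for the size of a system\<close>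

text \<open>A larger system would have defect \<open>e \<le> d - 1\<close>. The Griesmer bound for
  the whole space then makes the floor sum of \<open>e\<close> at least \<open>i [h]\<close>,
  against \<open>less\<close>.\<close>

lemma system_size_le:
  fixes S :: "('a::{field,finite} ^ 'n::finite) set multiset"
  defines "q \<equiv> CARD('a)" and "r \<equiv> CARD('n)"
  assumes h: "1 \<le> h" "h < r"
    and A: "A * qnum q h = qnum q (r - h)" and B: "B * qnum q h = qnum q r"
    and less: "(\<Sum>j=1..r - h. (d - 1) div q ^ j) < i * qnum q h" and d: "1 \<le> d"
    and S: "\<And>U. U \<in># S \<Longrightarrow> vec.subspace U \<and> vec.dim U \<le> h"
    and count: "\<And>H. hyperplane H \<Longrightarrow> int (contained_count S H) \<le> int A * int t - int i"
  shows "int (size S) \<le> int B * int t - int (i + d)"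
proof (rule ccontr)
  assume "\<not> ?thesis"
  then have large: "int B * int t - int i - int (size S) \<le> int (d - 1)"
    using d by (simp add: of_nat_diff)
  have q: "1 < q"
    unfolding q_def by (rule card_field_gt_1)
  \<comment> \<open>Enlarging elements to dimension \<open>h\<close> cannot raise the count in a
    hyperplane: one that contains \<open>g U\<close> contains \<open>U\<close>.\<close>
  have "\<exists>U'. vec.subspace U' \<and> U \<subseteq> U' \<and> vec.dim U' = h" if "U \<in># S" for U
  proof (rule subspace_between[of U UNIV h])
    show "h \<le> vec.dim (UNIV :: ('a ^ 'n) set)"
      using h by (simp add: r_def vec_dim_card card_cart_basis)
  qed (use S that in auto)
  then obtain g where g: "\<And>U. U \<in># S \<Longrightarrow> vec.subspace (g U) \<and> U \<subseteq> g U \<and> vec.dim (g U) = h"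
    by metis
  define S' where "S' = image_mset g S"
  have S': "vec.subspace U \<and> vec.dim U = h" if "U \<in># S'" for U
    using that g by (auto simp: S'_def)
  have size_S': "size S' = size S"
    by (simp add: S'_def)
  have count': "int (contained_count S' H) \<le> int A * int t - int i" if "hyperplane H" for H
  proof -
    have "contained_count S' H = size {#U \<in># S. g U \<subseteq> H#}"
      by (simp add: contained_count_def S'_def filter_mset_image_mset)
    also have "{#U \<in># S. g U \<subseteq> H#} = {#U \<in># {#U \<in># S. U \<subseteq> H#}. g U \<subseteq> H#}"
      unfolding filter_filter_mset using g by (intro filter_mset_cong) blast+
    also have "size \<dots> \<le> contained_count S H"
      unfolding contained_count_def by (intro size_mset_mono multiset_filter_subset)
    finally show ?thesis
      using count[OF that] by simp
  qed
  \<comment> \<open>The shortfall of the guaranteed missing number against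
    \<open>q^(r - h) t\<close>; it may be negative, hence an integer.\<close>
  define e where "e = int q ^ (r - h) * int t - (int (size S) - (int A * int t - int i))"
  have "qnum q r = qnum q (r - h) + q ^ (r - h) * qnum q h"
    using h qnum_add[of q "r - h" h] by simp
  then have B_eq: "int (qnum q r) = int A * int (qnum q h) + int q ^ (r - h) * int (qnum q h)"
    using arg_cong[OF A, of int] by simp
  have "(int B - int A - int q ^ (r - h)) * int (qnum q h) = 0"
    using B_eq by (simp add: algebra_simps flip: B)
  moreover have "0 < qnum q h"
    using h by (cases h) (simp_all add: qnum_Suc)
  ultimately have BA: "int B = int A + int q ^ (r - h)"
    by simp
  have e_le: "e \<le> int (d - 1)"
    using large by (simp add: e_def BA algebra_simps)
  have "int q ^ (r - 1) * int t - int q ^ (h - 1) * e \<le> point_weight S' UNIV - point_weight S' X"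
    if "X \<in> facets UNIV" for X
  proof -
    have X: "hyperplane X"
      using that by (simp add: facets_def hyperplane_def vec_dim_card card_cart_basis)
    have "int q ^ (r - 1) = int q ^ (h - 1) * int q ^ (r - h)"
      using h by (simp flip: power_add)
    then have "int q ^ (r - 1) * int t - int q ^ (h - 1) * e =
        (int (size S) - (int A * int t - int i)) * int q ^ (h - 1)"
      by (simp add: e_def algebra_simps)
    also have "\<dots> \<le> (int (size S') - int (contained_count S' X)) * int q ^ (h - 1)"
      using count'[OF X] size_S' by (intro mult_right_mono) auto
    also have "\<dots> = point_weight S' UNIV - point_weight S' X"
      using point_weight_hyperplane[OF S' h(1) X] by (simp add: q_def)
    finally show ?thesis .
  qed
  then have "int (qnum q r) * int t - (\<Sum>j<r. (int q ^ (h - 1) * e) div int q ^ j) \<le> point_weight S' UNIV"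
    unfolding q_def
    by (intro griesmer_bound)
      (use S' in \<open>auto simp: vec.subspace_UNIV vec_dim_card card_cart_basis r_def\<close>)
  also have "point_weight S' UNIV = int (size S) * int (qnum q h)"
  proof -
    have "point_weight S' UNIV = (\<Sum>U\<in>#S'. int (qnum q h))"
      unfolding point_weight_def q_def using S' by (intro arg_cong[of _ _ sum_mset] image_mset_cong) simp
    then show ?thesis
      by (simp add: size_S')
  qed
  finally have "int (qnum q r) * int t - (int (qnum q h) * e + (\<Sum>j=1..r - h. e div int q ^ j))
      \<le> int (size S) * int (qnum q h)"
    using sum_div_power_shift[of "int q" h e "r - h"] q h by (simp add: qnum_def)
  \<comment> \<open>After expanding \<open>[r]\<close> and the size, all terms in \<open>t\<close>
    and \<open>[h] e\<close> cancel.\<close>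
  then have "int i * int (qnum q h) \<le> (\<Sum>j=1..r - h. e div int q ^ j)"
    unfolding B_eq by (simp add: e_def algebra_simps)
  also have "\<dots> \<le> (\<Sum>j=1..r - h. int (d - 1) div int q ^ j)"
    using e_le q by (intro sum_mono zdiv_mono1) auto
  also have "\<dots> = int (\<Sum>j=1..r - h. (d - 1) div q ^ j)"
    by (simp add: zdiv_int)
  also have "\<dots> < int (i * qnum q h)"
    using less by (simp only: of_nat_less_iff)
  finally show False
    by simp
qed

text \<open>The floor sum is monotone in \<open>d\<close>, so \<open>le\<close> and
  \<open>less\<close> single out the least \<open>d\<close> at which it reaches
  \<open>i [h]\<close>. The construction and the upper bound meet at this \<open>d\<close>.\<close>

theorem eventually_max_system_size:
  defines "q \<equiv> CARD('a::{field,finite})" and "r \<equiv> CARD('n::finite)"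
  assumes h: "1 \<le> h" "h < r"
    and A: "A * qnum q h = qnum q (r - h)" and B: "B * qnum q h = qnum q r"
    and le: "i * qnum q h \<le> (\<Sum>j=1..r - h. d div q ^ j)"
    and less: "(\<Sum>j=1..r - h. (d - 1) div q ^ j) < i * qnum q h"
  shows "\<exists>t\<^sub>0. \<forall>t\<ge>t\<^sub>0. int (max_system_size TYPE('a::{field,finite} ^ 'n::finite) h (A * t - i)) =
    int B * int t - int (i + d)"
proof -
  have d: "1 \<le> d"
    using le less by (cases d) simp_all
  have A_pos: "1 \<le> A"
    using A h by (cases A; cases "r - h") (simp_all add: qnum_Suc)
  obtain t0 where t0: "\<And>t. t \<ge> t0 \<Longrightarrow> \<exists>S :: ('a ^ 'n) set multiset.
    int (size S) = int B * int t - int (i + d) \<and>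
    (\<forall>U\<in>#S. vec.subspace U \<and> vec.dim U = h) \<and>
    (\<forall>H. hyperplane H \<longrightarrow> int (contained_count S H) \<le> int A * int t - int i)"
    using ex_large_system[OF h[unfolded r_def] A[unfolded q_def r_def]
        B[unfolded q_def r_def] le[unfolded q_def r_def]] by blast
  show ?thesis
  \<comment> \<open>With \<open>A \<ge> 1\<close>, \<open>t \<ge> i\<close> makes
    \<open>A * t - i\<close> a genuine difference of naturals.\<close>
  proof (intro exI[of _ "max t0 i"] allI impI)
    fix t assume t: "max t0 i \<le> t"
    then have "i \<le> A * t"
      using mult_le_mono[OF A_pos, of i t] by simp
    then have s: "int (A * t - i) = int A * int t - int i"
      by (simp add: of_nat_diff)
    obtain S :: "('a ^ 'n) set multiset" where S:
      "int (size S) = int B * int t - int (i + d)"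
      "\<And>U. U \<in># S \<Longrightarrow> vec.subspace U \<and> vec.dim U = h"
      "\<And>H. hyperplane H \<Longrightarrow> int (contained_count S H) \<le> int A * int t - int i"
      using t0[of t] t by auto
    let ?P = "\<lambda>n. \<exists>S :: ('a ^ 'n) set multiset. projective_system h n (A * t - i) S"
    have bound: "n \<le> size S" if "?P n" for n
    proof -
      obtain S' :: "('a ^ 'n) set multiset" where S': "projective_system h n (A * t - i) S'"
        using \<open>?P n\<close> by blast
      then have "int (size S') \<le> int B * int t - int (i + d)"
        using h A B less d s
        by (intro system_size_le[where h=h and A=A])
          (force simp: projective_system_def q_def r_def simp flip: s)+
      then show ?thesis
        using S(1) S' by (simp add: projective_system_def)
    qed
    \<comment> \<open>Padding makes the bound on hyperplanes sharp without shrinking the system;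
      \<open>bound\<close> then forces \<open>n = size S\<close>.\<close>
    obtain n where "size S \<le> n" "?P n"
      using ex_projective_system[of S h "A * t - i"] S s by (metis le_refl of_nat_le_iff)
    with bound have "?P (size S)"
      by (metis le_antisym)
    then have "max_system_size TYPE('a ^ 'n) h (A * t - i) = size S"
      unfolding max_system_size_def using bound by (intro Greatest_equality)
    then show "int (max_system_size TYPE('a ^ 'n) h (A * t - i)) = int B * int t - int (i + d)"
      using S(1) by simp
  qed
qed

subsection \<open>The parameter table\<close>

lemma q_number_eq_qnum: "2 \<le> q \<Longrightarrow> q_number q k = of_nat (qnum q k)"
  using arg_cong[OF power_eq_qnum[of q k], of "of_nat :: nat \<Rightarrow> rat"]
  by (simp add: q_number_def field_simps of_nat_diff)

lemma sum_upto_numeral: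
  "(\<Sum>j=Suc 0..numeral n. f j) = (\<Sum>j=Suc 0..pred_numeral n. f j) + f (numeral n :: nat)"
  by (simp add: numeral_eq_Suc)

text \<open>As \<open>h\<close> divides \<open>r\<close> in every entry, \<open>[r] / [h]\<close>
  over \<open>q\<close> is \<open>[r / h]\<close> over \<open>q^h\<close>, so the same
  \<open>A\<close> and \<open>B\<close> serve for the codes.\<close>

lemma parameter_table_numerics:
  assumes "((q, r, h), (A, B), T) \<in> parameter_table"
  shows "2 \<le> q \<and> 1 \<le> h \<and> h < r \<and> h dvd r \<and>
    A * qnum q h = qnum q (r - h) \<and> B * qnum q h = qnum q r \<and>
    A = qnum (q ^ h) (r div h - 1) \<and> B = qnum (q ^ h) (r div h)"
  using assms unfolding parameter_table_def
  by (elim insertE emptyE Pair_inject; hypsubst)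
    (simp_all add: qnum_def lessThan_nat_numeral lessThan_Suc)

text \<open>Evaluation shows that \<open>d = c - i\<close> is minimal for the subspace systems and
  \<open>d = c + \<delta> - i\<close> for the codes, where the element bound is 1 and
  \<open>[1] = 1\<close>.\<close>

lemma parameter_table_exponents:
  assumes "((q, r, h), (A, B), T) \<in> parameter_table"
  shows "\<forall>(i, c, \<delta>)\<in>T. i \<le> c \<and>
    i * qnum q h \<le> (\<Sum>j=1..r - h. (c - i) div q ^ j) \<and>
    (\<Sum>j=1..r - h. (c - i - 1) div q ^ j) < i * qnum q h \<and>
    i \<le> (\<Sum>j=1..r div h - 1. (c + \<delta> - i) div (q ^ h) ^ j) \<and>
    (\<Sum>j=1..r div h - 1. (c + \<delta> - i - 1) div (q ^ h) ^ j) < i"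
  using assms unfolding parameter_table_def
  by (elim insertE emptyE Pair_inject; hypsubst)
    (simp_all add: sum_upto_numeral qnum_def lessThan_nat_numeral lessThan_Suc)

text \<open>The exact value is used twice: over \<open>q\<close> with element bound
  \<open>h\<close>, and over \<open>q^h\<close> with element bound 1 in dimension
  \<open>r / h\<close>. The sizes \<open>B t - c\<close> and \<open>B t - (c + \<delta>)\<close>
  differ by \<delta>.\<close>

theorem theorem5:
  fixes q r h A B i c \<delta> :: nat
    and T :: "(nat \<times> nat \<times> nat) set"
  assumes "((q, r, h), (A, B), T) \<in> parameter_table"
    and "(i, c, \<delta>) \<in> T"
    and "CARD('a::{field,finite}) = q"
    and "CARD('n::finite) = r"
    and "CARD('b::{field,finite}) = q ^ h"
    and "int CARD('m::finite) = \<lceil>of_nat r / of_nat h :: rat\<rceil>"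
  shows "of_nat A = q_number q (r - h) / q_number q (gcd r h) \<and>
         of_nat B = q_number q r / q_number q (gcd r h) \<and>
         (\<exists>t\<^sub>0. \<forall>t \<ge> t\<^sub>0.
            int (max_system_size TYPE('a ^ 'n) h (A * t - i)) = int B * int t - int c \<and>
            int (max_system_size TYPE('a ^ 'n) h (A * t - i))
              - int (max_system_size TYPE('b ^ 'm) 1 (A * t - i)) = int \<delta>)"
proof -
  have q: "2 \<le> q" and h: "1 \<le> h" "h < r" "h dvd r"
    and A: "A * qnum q h = qnum q (r - h)" and B: "B * qnum q h = qnum q r"
    and A_eq: "A = qnum (q ^ h) (r div h - 1)" and B_eq: "B = qnum (q ^ h) (r div h)"
    using parameter_table_numerics[OF assms(1)] by blast+
  have A': "A * qnum (q ^ h) 1 = qnum (q ^ h) (r div h - 1)"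
    and B': "B * qnum (q ^ h) 1 = qnum (q ^ h) (r div h)"
    using A_eq B_eq by simp_all
  have i: "i \<le> c"
    and le: "i * qnum q h \<le> (\<Sum>j=1..r - h. (c - i) div q ^ j)"
    and less: "(\<Sum>j=1..r - h. (c - i - 1) div q ^ j) < i * qnum q h"
    and le': "i * qnum (q ^ h) 1 \<le> (\<Sum>j=1..r div h - 1. (c + \<delta> - i) div (q ^ h) ^ j)"
    and less': "(\<Sum>j=1..r div h - 1. (c + \<delta> - i - 1) div (q ^ h) ^ j) < i * qnum (q ^ h) 1"
    using parameter_table_exponents[OF assms(1)] assms(2) by fastforce+
  have r: "r = h * (r div h)"
    using h(3) by simp
  \<comment> \<open>Divisibility makes the ceiling in the code dimension exact.\<close>
  have "(of_nat r / of_nat h :: rat) = of_nat (r div h)"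
    using h(1) by (subst r) simp
  then have m: "CARD('m) = r div h"
    using assms(6) by simp
  have k: "1 < r div h"
    using h by (auto elim!: dvdE)
  have "qnum q h \<noteq> 0"
    using h(1) by (cases h) (simp_all add: qnum_Suc)
  then have "of_nat A = q_number q (r - h) / q_number q (gcd r h)"
    "of_nat B = q_number q r / q_number q (gcd r h)"
    using q h(3) by (simp_all add: q_number_eq_qnum gcd_nat.absorb2 field_simps flip: A B)
  moreover obtain t1 where t1: "\<And>t. t \<ge> t1 \<Longrightarrow>
      int (max_system_size TYPE('a ^ 'n) h (A * t - i)) = int B * int t - int (i + (c - i))"
    using eventually_max_system_size[where 'a='a and 'n='n, unfolded assms(3,4), OF h(1,2) A B le less]
    by blast
  moreover obtain t2 where t2: "\<And>t. t \<ge> t2 \<Longrightarrow>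
      int (max_system_size TYPE('b ^ 'm) 1 (A * t - i)) = int B * int t - int (i + (c + \<delta> - i))"
    using eventually_max_system_size[where 'a='b and 'n='m, unfolded assms(5) m,
        OF order_refl k A' B' le' less']
    by blast
  ultimately show ?thesis
    using i by (auto intro!: exI[of _ "max t1 t2"])
qed

end
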